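(* Let $0<\alpha\le 1$, $l>0$, $T>0$, and let $p\in C^1([0,l])$, $q\in C([0,l])$ with $p(x)>0$ and $q(x)\ge 0$ for all $x\in[0,l]$. Let $u_0\in\mathcal{M}_L$ and $L(u_0)\in\mathcal{M}_L$. Then the solution of the initial-boundary-value problem $$u(x,0)=u_0(x),\quad 0\le x\le l,$$ $$u(0,t)=u(l,t)=0,\quad 0\le t\le T,$$ for the one-dimensional time-fractional diffusion equation $$(D_t^{\alpha}u)(x,t)=\frac{\partial}{\partial x}\left(p(x)\frac{\partial u}{\partial x}\right)-q(x)\,u,\quad x\in(0,l),\ t\in(0,T),$$ exists, is unique, and is given by the formula $$u(x,t)=\sum_{i=1}^{\infty}(u_0,X_i)\,E_{\alpha}(-\lambda_i t^{\alpha})\,X_i(x),$$ where $X_i$, $i=1,2,\dots$, are the eigenfunctions corresponding to the eigenvalues $\lambda_i$ of the eigenvalue problem $L(X)=\lambda X$ on $(0,l)$, $X(0)=X(l)=0$.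
   Context: The operator $L$ is $L(f):=-\frac{d}{dx}\left(p(x)\frac{df}{dx}\right)+q(x)f$ on $(0,l)$. The space $\mathcal{M}_L$ consists of the functions $f\in C^1([0,l])\cap C^2((0,l))$ with $f(0)=f(l)=0$ and $L(f)\in L^2(0,l)$. The eigenvalue problem $L(X)=\lambda X$, $X(0)=X(l)=0$ has countably many eigenvalues $0<\lambda_1\le\lambda_2\le\dots$ (listed with multiplicity), with corresponding eigenfunctions $X_i\in\mathcal{M}_L$, $L(X_i)=\lambda_iX_i$, forming a complete orthonormal system in $L^2(0,l)$. The symbol $(f,g)$ denotes the standard scalar product in $L^2(0,l)$. The Mittag-Leffler function is $E_\alpha(z):=\sum_{k=0}^\infty \frac{z^k}{\Gamma(\alpha k+1)}$. The Caputo fractional derivative of order $\alpha$, $0<\alpha\le 1$, is $(D^\alpha f)(t):=(I^{1-\alpha}f')(t)$, where $(I^{\gamma}f)(t):=\frac{1}{\Gamma(\gamma)}\int_0^t(t-\tau)^{\gamma-1}f(\tau)\,d\tau$ for $0<\gamma<1$ and $I^0f:=f$. The symbol $D_t^\alpha$ denotes this derivative applied in the variable $t$ for fixed $x$. A solution of the problem is a function $u=u(x,t)$ defined on $[0,l]\times[0,T]$, belonging to $C([0,l]\times[0,T])\cap W^1_t((0,T])\cap C^2_x((0,l))$, and satisfying the equation and the initial and boundary conditions. Here $W^1_t((0,T])$ refers to the space of functions $f\in C^1((0,T])$ with $f'\in L^1((0,T))$, in the variable $t$, and $C^2_x((0,l))$ means twice continuously differentiable in the variable $x$ on $(0,l)$.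 *)

theory Defs
  imports "HOL-Analysis.Analysis"
begin

text \<open>One-sided derivatives are used at those endpoints of an interval that belong to it, so values
  of a function outside the interval are irrelevant. The notion is meant for intervals with more
  than one point, on which the derivative is unique.\<close>

primrec Ck_on :: "nat \<Rightarrow> real set \<Rightarrow> (real \<Rightarrow> real) \<Rightarrow> bool" where
  "Ck_on 0 S f \<longleftrightarrow> continuous_on S f"
| "Ck_on (Suc k) S f \<longleftrightarrow>
     (\<exists>f'. (\<forall>x\<in>S. (f has_real_derivative f' x) (at x within S)) \<and> Ck_on k S f')"

definition L2 :: "real \<Rightarrow> (real \<Rightarrow> real) set" where
  "L2 l = {f. f \<in> borel_measurable (lebesgue_on {0<..<l}) \<and>
              integrable (lebesgue_on {0<..<l}) (\<lambda>x. (f x)\<^sup>2)}"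

definition L2_inner :: "real \<Rightarrow> (real \<Rightarrow> real) \<Rightarrow> (real \<Rightarrow> real) \<Rightarrow> real" where
  "L2_inner l f g = (\<integral>x. f x * g x \<partial>lebesgue_on {0<..<l})"

text \<open>The operator is only meaningful at points of the open interval: a function that is
  \<open>C\<^sup>2\<close> in the interior need not have second derivatives at the endpoints.\<close>

definition SL_op :: "(real \<Rightarrow> real) \<Rightarrow> (real \<Rightarrow> real) \<Rightarrow> (real \<Rightarrow> real) \<Rightarrow> real \<Rightarrow> real" where
  "SL_op p q f x = - deriv (\<lambda>y. p y * deriv f y) x + q x * f x"

text \<open>The space \<open>\<M>\<^sub>L\<close>. As \<open>SL_op p q f\<close> is a function on \<open>(0, l)\<close>,
  the condition \<open>L f \<in> \<M>\<^sub>L\<close> has to be read as: the function \<open>L f\<close> on \<open>(0, l)\<close> is the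
  restriction of some (necessarily unique on \<open>[0, l]\<close>) element of \<open>\<M>\<^sub>L\<close>.\<close>

definition SL_space :: "real \<Rightarrow> (real \<Rightarrow> real) \<Rightarrow> (real \<Rightarrow> real) \<Rightarrow> (real \<Rightarrow> real) set" where
  "SL_space l p q = {f. Ck_on 1 {0..l} f \<and> Ck_on 2 {0<..<l} f \<and>
                        f 0 = 0 \<and> f l = 0 \<and> SL_op p q f \<in> L2 l}"

definition SL_eigenfunction ::
    "real \<Rightarrow> (real \<Rightarrow> real) \<Rightarrow> (real \<Rightarrow> real) \<Rightarrow> real \<Rightarrow> (real \<Rightarrow> real) \<Rightarrow> bool" where
  "SL_eigenfunction l p q \<mu> Y \<longleftrightarrow>
     Y \<in> SL_space l p q \<and> (\<exists>x\<in>{0..l}. Y x \<noteq> 0) \<and>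
     (\<forall>x\<in>{0<..<l}. SL_op p q Y x = \<mu> * Y x)"

definition SL_eigenvalue :: "real \<Rightarrow> (real \<Rightarrow> real) \<Rightarrow> (real \<Rightarrow> real) \<Rightarrow> real \<Rightarrow> bool" where
  "SL_eigenvalue l p q \<mu> \<longleftrightarrow> (\<exists>Y. SL_eigenfunction l p q \<mu> Y)"

definition orthonormal_L2 :: "real \<Rightarrow> (nat \<Rightarrow> real \<Rightarrow> real) \<Rightarrow> bool" where
  "orthonormal_L2 l X \<longleftrightarrow>
     (\<forall>i. X i \<in> L2 l) \<and> (\<forall>i j. L2_inner l (X i) (X j) = (if i = j then 1 else 0))"

definition complete_L2 :: "real \<Rightarrow> (nat \<Rightarrow> real \<Rightarrow> real) \<Rightarrow> bool" where
  "complete_L2 l X \<longleftrightarrow>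
     (\<forall>f\<in>L2 l. (\<forall>i. L2_inner l f (X i) = 0) \<longrightarrow> (AE x in lebesgue_on {0<..<l}. f x = 0))"

text \<open>The eigenvalues are enumerated starting from index 0. That each is listed according to its
  multiplicity is a consequence of orthonormality and completeness: eigenfunctions for distinct
  eigenvalues are orthogonal, so the \<open>X i\<close> with \<open>ev i = \<mu>\<close> form a basis of the eigenspace
  of \<open>\<mu>\<close>.\<close>

definition SL_eigensystem ::
    "real \<Rightarrow> (real \<Rightarrow> real) \<Rightarrow> (real \<Rightarrow> real) \<Rightarrow> (nat \<Rightarrow> real) \<Rightarrow> (nat \<Rightarrow> real \<Rightarrow> real) \<Rightarrow> bool" where
  "SL_eigensystem l p q ev X \<longleftrightarrow>
     range ev = {\<mu>. SL_eigenvalue l p q \<mu>} \<and> (\<forall>i. 0 < ev i) \<and> mono ev \<and>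
     (\<forall>i. SL_eigenfunction l p q (ev i) (X i)) \<and> orthonormal_L2 l X \<and> complete_L2 l X"

definition mittag_leffler :: "real \<Rightarrow> 'a::real_normed_field \<Rightarrow> 'a" where
  "mittag_leffler \<alpha> z = (\<Sum>k. z ^ k / of_real (Gamma (\<alpha> * real k + 1)))"

definition RL_integral :: "real \<Rightarrow> (real \<Rightarrow> real) \<Rightarrow> real \<Rightarrow> real" where
  "RL_integral \<gamma> f t =
     (if \<gamma> = 0 then f t
      else 1 / Gamma \<gamma> * (\<integral>\<tau>. (t - \<tau>) powr (\<gamma> - 1) * f \<tau> \<partial>lebesgue_on {0<..<t}))"

definition caputo_deriv :: "real \<Rightarrow> (real \<Rightarrow> real) \<Rightarrow> real \<Rightarrow> real" where
  "caputo_deriv \<alpha> f t = RL_integral (1 - \<alpha>) (deriv f) t"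

definition W1 :: "real \<Rightarrow> (real \<Rightarrow> real) set" where
  "W1 T = {f. Ck_on 1 {0<..T} f \<and> integrable (lebesgue_on {0<..<T}) (deriv f)}"

definition diffusion_solution ::
    "real \<Rightarrow> real \<Rightarrow> real \<Rightarrow> (real \<Rightarrow> real) \<Rightarrow> (real \<Rightarrow> real) \<Rightarrow> (real \<Rightarrow> real) \<Rightarrow>
     (real \<Rightarrow> real \<Rightarrow> real) \<Rightarrow> bool" where
  "diffusion_solution \<alpha> l T p q u0 u \<longleftrightarrow>
     continuous_on ({0..l} \<times> {0..T}) (\<lambda>(x, t). u x t) \<and>
     (\<forall>x\<in>{0..l}. (\<lambda>t. u x t) \<in> W1 T) \<and>
     (\<forall>t\<in>{0..T}. Ck_on 2 {0<..<l} (\<lambda>x. u x t)) \<and>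
     (\<forall>x\<in>{0..l}. u x 0 = u0 x) \<and>
     (\<forall>t\<in>{0..T}. u 0 t = 0 \<and> u l t = 0) \<and>
     (\<forall>x\<in>{0<..<l}. \<forall>t\<in>{0<..<T}.
        caputo_deriv \<alpha> (\<lambda>s. u x s) t =
          deriv (\<lambda>y. p y * deriv (\<lambda>z. u z t) y) x - q x * u x t)"

end

theory Submission
  imports Defs
begin

text \<open>
  Separation of variables. With \<open>c i = (u\<^sub>0, X i)\<close> and \<open>y i t = E\<^sub>\<alpha>(- ev i * t\<^sup>\<alpha>)\<close> every summand
  \<open>c i * y i t * X i x\<close> satisfies the boundary conditions and the equation; the work lies in
  justifying all termwise operations, and in uniqueness.

  \<^bold>\<open>Time factors.\<close> The function \<open>y i\<close> solves the relaxation equation \<open>D\<^sup>\<alpha> y = - ev i * y\<close>, and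
  \<open>y i' = - ev i * k\<close> with the kernel \<open>k t = t\<^sup>\<alpha>\<^sup>-\<^sup>1 E\<^sub>\<alpha>\<^sub>,\<^sub>\<alpha>(- ev i * t\<^sup>\<alpha>)\<close>. Convolving power series termwise
  (Beta integral) shows that \<open>k\<close> solves a Volterra equation whose kernel is proportional to
  \<open>t\<^sup>\<alpha>\<^sup>-\<^sup>1\<close>. That power is log-convex, which forces \<open>k > 0\<close> (\<open>ml2_pos\<close>). Positivity gives all the estimates:
  \<open>0 \<le> y i \<le> 1\<close> (\<open>mittag_leffler_bounds\<close>) and \<open>\<bar>y i'\<bar> \<le> ev i * t\<^sup>\<alpha>\<^sup>-\<^sup>1 / \<Gamma>(\<alpha>)\<close>. The second bound depends on
  \<open>i\<close> only through the factor \<open>ev i\<close>, so that a superposition of relaxations may be differentiated and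
  Caputo-differentiated termwise (\<open>relaxation_superposition\<close>).

  \<^bold>\<open>Space factors.\<close> Green's formula and a one-dimensional Sobolev estimate give
  \<open>f(x)\<^sup>2 \<le> C (L f, f)\<close>. Applied to finite sums of eigenfunctions, this yields a bound for
  \<open>\<Sum>i. X i(x)\<^sup>2 / ev i\<close> that does not depend on \<open>x\<close>; the Cauchy-Schwarz and Bessel inequalities then show that
  Fourier series of functions in \<open>\<M>\<^sub>L\<close> converge absolutely and uniformly, and by completeness the
  sum is the function itself (\<open>fourier_expansion\<close>). This applies to \<open>u\<^sub>0\<close> and, because
  \<open>L u\<^sub>0 \<in> \<M>\<^sub>L\<close>, also to \<open>L u\<^sub>0\<close>, whose coefficients are \<open>ev i * c i\<close>. Uniform convergence of these two
  series is what is needed to apply \<open>L\<close> termwise (\<open>termwise_SL_operator\<close>) and to differentiate in time.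

  \<^bold>\<open>Uniqueness.\<close> At a point where a function attains its maximum over the past, its Caputo derivative is
  nonnegative (\<open>caputo_extremum_principle\<close>), while at an interior maximum in space the flux
  term \<open>(p f')'\<close> is nonpositive. Hence the difference of two solutions, perturbed by \<open>- \<epsilon> t\<close>, has no
  positive interior maximum (\<open>diffusion_solution_le\<close>).
\<close>

section \<open>Integration on intervals\<close>

lemma has_bochner_integral_lebesgue_onI:
  fixes f :: "'a::euclidean_space \<Rightarrow> real"
  assumes "(f has_integral I) S" "\<And>x. x \<in> S \<Longrightarrow> 0 \<le> f x" "S \<in> sets lebesgue"
  shows "has_bochner_integral (lebesgue_on S) f I"
proof -
  have "f absolutely_integrable_on S"
    using assms by (intro nonnegative_absolutely_integrable_1) auto
  then have i: "integrable (lebesgue_on S) f"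
    using assms(3) by (rule absolutely_integrable_imp_integrable)
  moreover have "integral\<^sup>L (lebesgue_on S) f = I"
    using lebesgue_integral_eq_integral[OF i assms(3)] assms(1) by auto
  ultimately show ?thesis by (simp add: has_bochner_integral_iff)
qed

lemma has_bochner_integral_lebesgue_onD:
  fixes f :: "'a::euclidean_space \<Rightarrow> 'b::euclidean_space"
  assumes "has_bochner_integral (lebesgue_on S) f I" "S \<in> sets lebesgue"
  shows "(f has_integral I) S"
  using has_integral_integral_lebesgue_on[of S f] assms by (simp add: has_bochner_integral_iff)

lemma integrable_lebesgue_on_Ioo_continuous:
  fixes f :: "real \<Rightarrow> real"
  assumes "continuous_on {a..b} f"
  shows "integrable (lebesgue_on {a<..<b}) f"
proof -
  have "f absolutely_integrable_on cbox a b"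
    using assms by (intro absolutely_integrable_continuous) simp
  then have "f absolutely_integrable_on box a b"
    by (simp only: absolutely_integrable_on_open_interval)
  then have "f absolutely_integrable_on {a<..<b}" by (simp only: box_real)
  then show ?thesis by (rule absolutely_integrable_imp_integrable) simp
qed

lemma has_integral_Icc_lebesgue_on_Ioo:
  fixes f :: "real \<Rightarrow> real"
  assumes "integrable (lebesgue_on {a<..<b}) f"
  shows "(f has_integral (\<integral>x. f x \<partial>lebesgue_on {a<..<b})) {a..b}"
  using has_integral_integral_lebesgue_on[OF assms] by (simp add: has_integral_Icc_iff_Ioo)

lemma integrable_lebesgue_on_subset:
  fixes f :: "real \<Rightarrow> real"
  assumes "integrable (lebesgue_on S) f" "T \<subseteq> S" "S \<in> sets lebesgue" "T \<in> sets lebesgue"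
  shows "integrable (lebesgue_on T) f"
proof -
  have "set_integrable lebesgue S f"
    using assms by (simp add: set_integrable_def integrable_restrict_space)
  then have "set_integrable lebesgue T f" using assms by (auto intro: set_integrable_subset)
  then show ?thesis using assms by (simp add: set_integrable_def integrable_restrict_space)
qed

lemma integral_powr_diff:
  fixes a b r :: real
  assumes "0 < r" "a \<le> b"
  shows "((\<lambda>s. (b - s) powr (r - 1)) has_integral (b - a) powr r / r) {a..b}"
proof -
  have "((\<lambda>s. (b - s) powr (r - 1)) has_integral (- ((b - b) powr r / r) - - ((b - a) powr r / r))) {a..b}"
  proof (rule fundamental_theorem_of_calculus_interior)
    show "continuous_on {a..b} (\<lambda>s. - ((b - s) powr r / r))"
      using assms by (intro continuous_intros continuous_on_powr') auto
    fix x assume x: "x \<in> {a<..<b}"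
    have "((\<lambda>s. - ((b - s) powr r / r)) has_real_derivative - ((r * (b - x) powr (r - 1) * (-1)) / r)) (at x)"
      using x assms by (auto intro!: derivative_eq_intros)
    then show "((\<lambda>s. - ((b - s) powr r / r)) has_vector_derivative (b - x) powr (r - 1)) (at x)"
      using assms by (simp add: has_real_derivative_iff_has_vector_derivative)
  qed (use assms in auto)
  then show ?thesis by simp
qed

text \<open>Euler's Beta integral, rescaled from \<open>[0, 1]\<close>: the semigroup law of the fractional
  integrals on powers.\<close>

lemma has_bochner_integral_Beta:
  fixes t :: real
  assumes "0 < a" "0 < b" "0 < t"
  shows "has_bochner_integral (lebesgue_on {0<..<t}) (\<lambda>s. (t - s) powr (a - 1) * s powr (b - 1))
           (t powr (a + b - 1) * Gamma a * Gamma b / Gamma (a + b))"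
proof (rule has_bochner_integral_lebesgue_onI)
  have "((\<lambda>s. s powr (b - 1) * (1 - s) powr (a - 1)) has_integral Beta b a) {0..1}"
    using assms by (intro has_integral_Beta_real)
  from has_integral_stretch_real[OF this, of "1 / t"] assms
  have "((\<lambda>s. (s / t) powr (b - 1) * (1 - s / t) powr (a - 1)) has_integral t * Beta b a) ((\<lambda>x. x * t) ` {0..1})"
    by simp
  also have "(\<lambda>x. x * t) ` {0..1} = {0..t}"
    using assms image_mult_atLeastAtMost_if'[of t 0 1] by simp
  finally have "((\<lambda>s. (s / t) powr (b - 1) * (1 - s / t) powr (a - 1)) has_integral t * Beta b a) {0<..<t}"
    by (simp add: has_integral_Icc_iff_Ioo)
  then have "((\<lambda>s. t powr (a + b - 2) * ((s / t) powr (b - 1) * (1 - s / t) powr (a - 1))) has_integral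
      t powr (a + b - 2) * (t * Beta b a)) {0<..<t}" by (rule has_integral_mult_right)
  also have "t powr (a + b - 2) * (t * Beta b a) = t powr (a + b - 1) * Gamma a * Gamma b / Gamma (a + b)"
  proof -
    have "t powr (a + b - 2) * t = t powr (a + b - 2) * t powr 1" using assms by simp
    also have "\<dots> = t powr (a + b - 1)" unfolding powr_add [symmetric] by simp
    finally show ?thesis by (simp add: Beta_def mult_ac add_ac)
  qed
  finally show "((\<lambda>s. (t - s) powr (a - 1) * s powr (b - 1)) has_integral
      (t powr (a + b - 1) * Gamma a * Gamma b / Gamma (a + b))) {0<..<t}"
  proof (rule has_integral_eq [rotated])
    fix s assume s: "s \<in> {0<..<t}"
    have 1: "1 - s / t = (t - s) / t" using assms by (simp add: field_simps)
    have 2: "t powr (a + b - 2) = t powr (a - 1) * t powr (b - 1)"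
      unfolding powr_add [symmetric] by simp
    have 3: "t powr (a - 1) > 0" "t powr (b - 1) > 0" using assms by auto
    show "t powr (a + b - 2) * ((s / t) powr (b - 1) * (1 - s / t) powr (a - 1)) = (t - s) powr (a - 1) * s powr (b - 1)"
      unfolding 1 2 using s assms 3 by (simp add: powr_divide)
  qed
qed auto

text \<open>The two singularities do not meet: up to \<open>t / 2\<close> the power is bounded and \<open>f'\<close> is integrable,
  beyond \<open>t / 2\<close> it is \<open>f'\<close> that is bounded and the power that is integrable.\<close>

lemma weakly_singular_integrable:
  fixes f' :: "real \<Rightarrow> real"
  assumes \<gamma>: "0 < \<gamma>" "\<gamma> \<le> 1" and t: "0 < t" and int: "integrable (lebesgue_on {0<..<t}) f'"
    and cont: "continuous_on {0<..t} f'"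
  shows "integrable (lebesgue_on {0<..<t}) (\<lambda>\<tau>. (t - \<tau>) powr (\<gamma> - 1) * f' \<tau>)"
proof -
  let ?M = "lebesgue_on {0<..<t}"
  have "compact (f' ` {t/2..t})"
    using t by (intro compact_continuous_image continuous_on_subset[OF cont]) auto
  then obtain K where K: "K > 0" "\<forall>y\<in>f' ` {t/2..t}. norm y \<le> K"
    using compact_imp_bounded bounded_pos by blast
  have i: "integrable ?M (\<lambda>\<tau>. (t / 2) powr (\<gamma> - 1) * \<bar>f' \<tau>\<bar> + K * (t - \<tau>) powr (\<gamma> - 1))"
  proof (intro Bochner_Integration.integrable_add integrable_mult_right integrable_abs int)
    have "((\<lambda>s. (t - s) powr (\<gamma> - 1)) has_integral t powr \<gamma> / \<gamma>) {0<..<t}"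
      using integral_powr_diff[of \<gamma> 0 t] \<gamma> t by (simp add: has_integral_Icc_iff_Ioo)
    then have "has_bochner_integral ?M (\<lambda>s. (t - s) powr (\<gamma> - 1)) (t powr \<gamma> / \<gamma>)"
      by (rule has_bochner_integral_lebesgue_onI) auto
    then show "integrable ?M (\<lambda>\<tau>. (t - \<tau>) powr (\<gamma> - 1))" by (simp add: has_bochner_integral_iff)
  qed
  show ?thesis
  proof (rule Bochner_Integration.integrable_bound[OF i])
    have "continuous_on {0<..<t} (\<lambda>\<tau>. (t - \<tau>) powr (\<gamma> - 1))" by (intro continuous_intros) auto
    then have "(\<lambda>\<tau>. (t - \<tau>) powr (\<gamma> - 1)) \<in> borel_measurable ?M"
      by (rule continuous_imp_measurable_on_sets_lebesgue) simp
    then show "(\<lambda>\<tau>. (t - \<tau>) powr (\<gamma> - 1) * f' \<tau>) \<in> borel_measurable ?M"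
      using int by (intro borel_measurable_times) auto
    have "norm ((t - \<tau>) powr (\<gamma> - 1) * f' \<tau>) \<le> (t / 2) powr (\<gamma> - 1) * \<bar>f' \<tau>\<bar> + K * (t - \<tau>) powr (\<gamma> - 1)"
      if \<tau>: "\<tau> \<in> {0<..<t}" for \<tau>
    proof (cases "\<tau> \<le> t / 2")
      case True
      have "(t - \<tau>) powr (\<gamma> - 1) \<le> (t / 2) powr (\<gamma> - 1)"
        using True t \<gamma> by (intro powr_mono2') auto
      then have "(t - \<tau>) powr (\<gamma> - 1) * \<bar>f' \<tau>\<bar> \<le> (t / 2) powr (\<gamma> - 1) * \<bar>f' \<tau>\<bar>"
        by (rule mult_right_mono) auto
      then show ?thesis using K by (simp add: abs_mult add_increasing2)
    next
      case False
      then have "\<bar>f' \<tau>\<bar> \<le> K" using K(2) \<tau> by auto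
      then have "(t - \<tau>) powr (\<gamma> - 1) * \<bar>f' \<tau>\<bar> \<le> (t - \<tau>) powr (\<gamma> - 1) * K" by (rule mult_left_mono) auto
      then show ?thesis by (simp add: abs_mult mult.commute add_increasing)
    qed
    then show "AE \<tau> in ?M. norm ((t - \<tau>) powr (\<gamma> - 1) * f' \<tau>)
        \<le> norm ((t / 2) powr (\<gamma> - 1) * \<bar>f' \<tau>\<bar> + K * (t - \<tau>) powr (\<gamma> - 1))"
      by (intro AE_I2) fastforce
  qed
qed

section \<open>The two-parameter Mittag-Leffler function\<close>

text \<open>The function \<open>E\<^sub>\<alpha>\<^sub>,\<^sub>\<beta>\<close>. Besides \<open>\<beta> = 1\<close>, the case \<open>\<beta> = \<alpha>\<close> matters because it appears in the
  derivative of \<open>E\<^sub>\<alpha>\<close>.\<close>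

definition ml2 :: "real \<Rightarrow> real \<Rightarrow> real \<Rightarrow> real" where
  "ml2 \<alpha> \<beta> z = (\<Sum>k. z ^ k / Gamma (\<alpha> * real k + \<beta>))"

lemma mittag_leffler_conv_ml2: "mittag_leffler \<alpha> z = ml2 \<alpha> 1 z"
  by (simp add: mittag_leffler_def ml2_def)

lemma ml2_0 [simp]: "ml2 \<alpha> \<beta> 0 = 1 / Gamma \<beta>"
proof -
  have "(\<lambda>k. (1 / Gamma (\<alpha> * real k + \<beta>)) * 0 ^ k) sums (1 / Gamma (\<alpha> * real 0 + \<beta>))"
    by (rule powser_sums_zero)
  then show ?thesis by (simp add: ml2_def sums_iff)
qed

text \<open>Euler's integral restricted to \<open>[M, M + 1]\<close>. Since \<open>M\<close> is arbitrary, the Gamma function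
  outgrows every geometric sequence, so that the Mittag-Leffler series converge everywhere.\<close>

lemma Gamma_real_lower_bound:
  fixes x M :: real
  assumes "1 \<le> x" "0 < M"
  shows "M powr (x - 1) * exp (- (M + 1)) \<le> Gamma x"
proof -
  have *: "((\<lambda>t. t powr (x - 1) / exp t) has_integral Gamma x) {0..}"
    using assms by (intro Gamma_integral_real) auto
  have "M powr (x - 1) * exp (- (M + 1)) = integral {M..M+1} (\<lambda>t. M powr (x - 1) * exp (- (M + 1)))"
    using assms by simp
  also have "\<dots> \<le> integral {M..M+1} (\<lambda>t. t powr (x - 1) / exp t)"
  proof (rule integral_le)
    show "(\<lambda>t. t powr (x - 1) / exp t) integrable_on {M..M + 1}"
      using assms by (intro integrable_continuous_interval continuous_intros) auto
    fix t assume t: "t \<in> {M..M+1}"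
    have "M powr (x - 1) * exp (- (M + 1)) \<le> t powr (x - 1) * exp (- t)"
      using t assms by (intro mult_mono powr_mono2) auto
    then show "M powr (x - 1) * exp (- (M + 1)) \<le> t powr (x - 1) / exp t"
      by (simp add: exp_minus divide_inverse)
  qed auto
  also have "\<dots> \<le> integral {0..} (\<lambda>t. t powr (x - 1) / exp t)"
  proof (rule integral_subset_le)
    show "(\<lambda>t. t powr (x - 1) / exp t) integrable_on {M..M + 1}"
      using assms by (intro integrable_continuous_interval continuous_intros) auto
    show "(\<lambda>t. t powr (x - 1) / exp t) integrable_on {0..}" using * by auto
  qed (use assms in auto)
  also have "\<dots> = Gamma x" using * by auto
  finally show ?thesis .
qed

lemma ml2_summable_norm:
  fixes z :: real
  assumes "0 < \<alpha>" "0 < \<beta>"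
  shows "summable (\<lambda>k. norm (z ^ k / Gamma (\<alpha> * real k + \<beta>)))"
proof -
  \<comment> \<open>With this \<open>M\<close> the lower bound for the Gamma function grows like \<open>R\<^sup>n\<close>, and \<open>\<bar>z\<bar> \<le> R / 2\<close>.\<close>
  define R where "R = 2 * (\<bar>z\<bar> + 1)"
  define M where "M = R powr (1 / \<alpha>)"
  have R: "R > 0" by (auto simp: R_def)
  then have M: "M > 0" by (simp add: M_def)
  define C where "C = exp (M + 1) * M powr (1 - \<beta>)"
  obtain N where N: "1 / \<alpha> < real N" using reals_Archimedean2 by blast
  show ?thesis
  proof (rule summable_comparison_test')
    show "summable (\<lambda>k. C * (1/2::real) ^ k)" by (intro summable_mult summable_geometric) auto
    fix n assume "N \<le> n"
    then have "1 / \<alpha> < real n" using N by linarith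
    then have "1 < \<alpha> * real n" using assms by (simp add: field_simps)
    then have n: "1 \<le> \<alpha> * real n + \<beta>" using assms by auto
    have "M powr (\<alpha> * real n + \<beta> - 1) = M powr (\<alpha> * real n) * M powr (\<beta> - 1)"
      by (simp add: powr_add [symmetric] algebra_simps)
    also have "M powr (\<alpha> * real n) = R ^ n"
      using assms R by (simp add: M_def powr_powr powr_realpow)
    finally have "R ^ n * M powr (\<beta> - 1) * exp (- (M + 1)) \<le> Gamma (\<alpha> * real n + \<beta>)"
      using Gamma_real_lower_bound[OF n M] by simp
    moreover have "R ^ n * M powr (\<beta> - 1) * exp (- (M + 1)) = R ^ n / C"
    proof -
      have "M powr (1 - \<beta>) * M powr (\<beta> - 1) = M powr 0" unfolding powr_add [symmetric] by simp
      then have "M powr (1 - \<beta>) * M powr (\<beta> - 1) = 1" using M by simp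
      moreover have "exp (- (M + 1)) * exp (M + 1) = 1" using exp_minus_inverse[of "M + 1"] by (simp only: mult.commute)
      ultimately have "(M powr (\<beta> - 1) * exp (- (M + 1))) * C = 1"
        unfolding C_def by (metis (no_types, lifting) mult.assoc mult.commute mult.right_neutral)
      then have "M powr (\<beta> - 1) * exp (- (M + 1)) = 1 / C"
        by (metis div_by_0 eq_divide_imp mult_zero_right zero_neq_one)
      then show ?thesis by (simp add: mult.assoc)
    qed
    ultimately have G: "R ^ n / C \<le> Gamma (\<alpha> * real n + \<beta>)" by simp
    have C: "C > 0" using M by (simp add: C_def)
    have "\<bar>z\<bar> ^ n / Gamma (\<alpha> * real n + \<beta>) \<le> (R / 2) ^ n / (R ^ n / C)"
      using R C G by (intro frac_le power_mono) (auto simp: R_def)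
    also have "\<dots> = C * (1/2) ^ n" using R C by (simp add: power_divide field_simps)
    finally show "norm (norm (z ^ n / Gamma (\<alpha> * real n + \<beta>))) \<le> C * (1/2) ^ n"
      using assms by (simp add: power_abs abs_mult Gamma_real_pos add_nonneg_pos abs_of_pos)
  qed
qed

lemma ml2_summable:
  fixes z :: real
  assumes "0 < \<alpha>" "0 < \<beta>"
  shows "summable (\<lambda>k. z ^ k / Gamma (\<alpha> * real k + \<beta>))"
  using ml2_summable_norm[OF assms] by (rule summable_norm_cancel)

lemma ml2_rec:
  assumes "0 < \<alpha>" "0 < \<beta>"
  shows "ml2 \<alpha> \<beta> z = 1 / Gamma \<beta> + z * ml2 \<alpha> (\<alpha> + \<beta>) z"
proof -
  have "ml2 \<alpha> \<beta> z = (\<Sum>k. z ^ Suc k / Gamma (\<alpha> * real (Suc k) + \<beta>)) + z ^ 0 / Gamma (\<alpha> * real 0 + \<beta>)"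
    unfolding ml2_def by (subst suminf_split_head[OF ml2_summable[OF assms]]) simp
  also have "(\<Sum>k. z ^ Suc k / Gamma (\<alpha> * real (Suc k) + \<beta>)) = (\<Sum>k. z * (z ^ k / Gamma (\<alpha> * real k + (\<alpha> + \<beta>))))"
    by (simp add: algebra_simps)
  also have "\<dots> = z * ml2 \<alpha> (\<alpha> + \<beta>) z"
    unfolding ml2_def using assms by (intro suminf_mult ml2_summable) auto
  finally show ?thesis by simp
qed

lemma ml2_isCont:
  assumes "0 < \<alpha>" "0 < \<beta>"
  shows "isCont (ml2 \<alpha> \<beta>) z"
proof -
  have "((\<lambda>z. \<Sum>k. (1 / Gamma (\<alpha> * real k + \<beta>)) * z ^ k) has_field_derivative
     (\<Sum>k. diffs (\<lambda>k. 1 / Gamma (\<alpha> * real k + \<beta>)) k * z ^ k)) (at z)"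
    using ml2_summable[OF assms] by (intro termdiffs_strong_converges_everywhere) simp
  then show ?thesis by (simp add: ml2_def[abs_def] DERIV_isCont)
qed

lemma continuous_on_ml2_powr:
  assumes "0 < \<alpha>" "0 < \<beta>"
  shows "continuous_on {0..} (\<lambda>t. ml2 \<alpha> \<beta> (c * t powr \<alpha>))"
proof -
  have "continuous_on UNIV (ml2 \<alpha> \<beta>)" using ml2_isCont[OF assms] by (simp add: continuous_on_eq_continuous_at)
  moreover have "continuous_on {0..} (\<lambda>t::real. c * t powr \<alpha>)"
    using assms by (intro continuous_intros continuous_on_powr') auto
  ultimately show ?thesis by (rule continuous_on_compose2) auto
qed

lemma mittag_leffler_has_derivative:
  fixes z :: real
  assumes "0 < \<alpha>"
  shows "(mittag_leffler \<alpha> has_real_derivative ml2 \<alpha> \<alpha> z / \<alpha>) (at z)"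
proof -
  have "((\<lambda>z. \<Sum>k. (1 / Gamma (\<alpha> * real k + 1)) * z ^ k) has_field_derivative
     (\<Sum>k. diffs (\<lambda>k. 1 / Gamma (\<alpha> * real k + 1)) k * z ^ k)) (at z)"
    using ml2_summable[OF assms zero_less_one] by (intro termdiffs_strong_converges_everywhere) simp
  moreover have "diffs (\<lambda>k. 1 / Gamma (\<alpha> * real k + 1)) k * z ^ k = (z ^ k / Gamma (\<alpha> * real k + \<alpha>)) / \<alpha>" for k
  proof -
    define x where "x = \<alpha> * real (Suc k)"
    have x: "x > 0" "x = \<alpha> * real k + \<alpha>" using assms by (auto simp: x_def distrib_left intro: add_pos_nonneg)
    have "x \<notin> \<int>\<^sub>\<le>\<^sub>0" using x(1) nonpos_Ints_nonpos by force
    then have G: "Gamma (x + 1) = x * Gamma x" by (rule Gamma_plus1)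
    have "diffs (\<lambda>k. 1 / Gamma (\<alpha> * real k + 1)) k = real (Suc k) / Gamma (x + 1)"
      by (simp add: diffs_def x_def)
    also have "\<dots> = 1 / (\<alpha> * Gamma x)"
      unfolding G using assms by (simp add: x_def)
    finally show ?thesis by (simp add: x(2))
  qed
  moreover have "(\<Sum>k. (z ^ k / Gamma (\<alpha> * real k + \<alpha>)) / \<alpha>) = ml2 \<alpha> \<alpha> z / \<alpha>"
    unfolding ml2_def using ml2_summable[OF assms assms] by (rule suminf_divide)
  moreover have "mittag_leffler \<alpha> = (\<lambda>z. \<Sum>k. (1 / Gamma (\<alpha> * real k + 1)) * z ^ k)"
    by (simp add: mittag_leffler_def[abs_def])
  ultimately show ?thesis by simp
qed

lemma mittag_leffler_relaxation_has_derivative: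
  assumes "0 < \<alpha>" "0 < t"
  shows "((\<lambda>t. mittag_leffler \<alpha> (c * t powr \<alpha>)) has_real_derivative
          c * (t powr (\<alpha> - 1) * ml2 \<alpha> \<alpha> (c * t powr \<alpha>))) (at t)"
proof -
  have "((\<lambda>t. c * t powr \<alpha>) has_real_derivative c * (\<alpha> * t powr (\<alpha> - 1))) (at t)"
    using assms by (intro DERIV_cmult has_real_derivative_powr)
  from DERIV_chain2[OF mittag_leffler_has_derivative[OF assms(1)] this]
  show ?thesis using assms by (simp add: mult_ac)
qed

text \<open>Fractional integration of order \<open>\<gamma>\<close> shifts the second parameter by \<open>\<gamma>\<close>. The Beta integral
  gives this for each term, and the same computation with \<open>\<bar>c\<bar>\<close> in place of \<open>c\<close> supplies the
  absolute convergence that allows integrating termwise. With \<open>\<gamma> = \<alpha>\<close> one obtains the Volterra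
  equation of the relaxation kernel, with \<open>\<gamma> = 1 - \<alpha>\<close> the Caputo derivative of the relaxation
  function.\<close>

lemma ml2_convolution:
  assumes "0 < \<alpha>" "0 < \<beta>" "0 < \<gamma>" "0 < t"
  shows "has_bochner_integral (lebesgue_on {0<..<t})
      (\<lambda>s. (t - s) powr (\<gamma> - 1) * (s powr (\<beta> - 1) * ml2 \<alpha> \<beta> (c * s powr \<alpha>)))
      (Gamma \<gamma> * (t powr (\<gamma> + \<beta> - 1) * ml2 \<alpha> (\<gamma> + \<beta>) (c * t powr \<alpha>)))"
proof -
  let ?M = "lebesgue_on {0<..<t}"
  define b where "b n = \<alpha> * real n + \<beta>" for n
  define w where "w n s = (t - s) powr (\<gamma> - 1) * s powr (b n - 1)" for n s
  define f where "f n s = c ^ n / Gamma (b n) * w n s" for n s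
  have b: "b n > 0" for n using assms by (simp add: b_def add_nonneg_pos)
  have w: "has_bochner_integral ?M (w n) (t powr (\<gamma> + b n - 1) * Gamma \<gamma> * Gamma (b n) / Gamma (\<gamma> + b n))" for n
    unfolding w_def using assms b by (intro has_bochner_integral_Beta)
  have G: "Gamma (b n) > 0" for n using b by (rule Gamma_real_pos)
  have tp: "t powr (\<gamma> + b n - 1) = t powr (\<gamma> + \<beta> - 1) * (t powr \<alpha>) ^ n" for n
  proof -
    have "t powr (\<gamma> + b n - 1) = t powr (\<gamma> + \<beta> - 1) * t powr (\<alpha> * real n)"
      unfolding powr_add [symmetric] b_def by (simp add: algebra_simps)
    then show ?thesis using assms by (simp add: powr_powr powr_realpow [symmetric])
  qed
  have f: "has_bochner_integral ?M (f n)
      (Gamma \<gamma> * t powr (\<gamma> + \<beta> - 1) * ((c * t powr \<alpha>) ^ n / Gamma (\<alpha> * real n + (\<gamma> + \<beta>))))" for n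
  proof -
    have "has_bochner_integral ?M (f n)
        (c ^ n / Gamma (b n) * (t powr (\<gamma> + b n - 1) * Gamma \<gamma> * Gamma (b n) / Gamma (\<gamma> + b n)))"
      unfolding f_def using w[of n] by (intro has_bochner_integral_mult_right)
    moreover have "\<gamma> + b n = \<alpha> * real n + (\<gamma> + \<beta>)" by (simp add: b_def)
    ultimately show ?thesis using G[of n] unfolding tp
      by (simp add: power_mult_distrib mult_ac)
  qed
  have nf: "has_bochner_integral ?M (\<lambda>s. norm (f n s))
      (Gamma \<gamma> * t powr (\<gamma> + \<beta> - 1) * ((\<bar>c\<bar> * t powr \<alpha>) ^ n / Gamma (\<alpha> * real n + (\<gamma> + \<beta>))))" for n
  proof -
    have "has_bochner_integral ?M (\<lambda>s. \<bar>c\<bar> ^ n / Gamma (b n) * w n s)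
        (\<bar>c\<bar> ^ n / Gamma (b n) * (t powr (\<gamma> + b n - 1) * Gamma \<gamma> * Gamma (b n) / Gamma (\<gamma> + b n)))"
      using w[of n] by (intro has_bochner_integral_mult_right)
    moreover have "(\<lambda>s. \<bar>c\<bar> ^ n / Gamma (b n) * w n s) = (\<lambda>s. norm (f n s))"
      using G[of n] by (simp add: f_def w_def abs_mult power_abs fun_eq_iff)
    moreover have "\<gamma> + b n = \<alpha> * real n + (\<gamma> + \<beta>)" by (simp add: b_def)
    ultimately show ?thesis using G[of n] unfolding tp
      by (simp add: power_mult_distrib mult_ac)
  qed
  have fs: "f n s = (t - s) powr (\<gamma> - 1) * s powr (\<beta> - 1) * ((c * s powr \<alpha>) ^ n / Gamma (\<alpha> * real n + \<beta>))"
    if "0 < s" for n s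
  proof -
    have "s powr (b n - 1) = s powr (\<beta> - 1) * s powr (\<alpha> * real n)"
      unfolding powr_add [symmetric] b_def by (simp add: algebra_simps)
    also have "\<dots> = s powr (\<beta> - 1) * (s powr \<alpha>) ^ n"
      using that by (simp add: powr_powr powr_realpow [symmetric])
    finally show ?thesis by (simp add: f_def w_def b_def power_mult_distrib)
  qed
  have int: "integrable ?M (f n)" for n using f by (auto simp: has_bochner_integral_iff)
  have sm: "AE s in ?M. summable (\<lambda>n. norm (f n s))"
  proof (rule AE_I2)
    fix s assume "s \<in> space ?M"
    then have s: "s > 0" by auto
    show "summable (\<lambda>n. norm (f n s))"
      unfolding fs[OF s] norm_mult[of "(t - s) powr (\<gamma> - 1) * s powr (\<beta> - 1)"]
      by (intro summable_mult ml2_summable_norm assms)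
  qed
  have sn: "summable (\<lambda>n. (\<integral>s. norm (f n s) \<partial>?M))"
  proof -
    have "0 < \<gamma> + \<beta>" using assms by auto
    then have "summable (\<lambda>n. Gamma \<gamma> * t powr (\<gamma> + \<beta> - 1) * ((\<bar>c\<bar> * t powr \<alpha>) ^ n / Gamma (\<alpha> * real n + (\<gamma> + \<beta>))))"
      by (intro summable_mult ml2_summable assms)
    then show ?thesis using nf by (simp add: has_bochner_integral_iff)
  qed
  have eq: "(\<Sum>n. f n s) = (t - s) powr (\<gamma> - 1) * (s powr (\<beta> - 1) * ml2 \<alpha> \<beta> (c * s powr \<alpha>))"
    if "s \<in> space ?M" for s
  proof -
    have s: "s > 0" using that by auto
    show ?thesis unfolding fs[OF s] ml2_def mult.assoc[symmetric]
      by (intro suminf_mult ml2_summable assms)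
  qed
  have "has_bochner_integral ?M (\<lambda>s. \<Sum>n. f n s) (\<Sum>n. integral\<^sup>L ?M (f n))"
    using integrable_suminf[OF int sm sn] integral_suminf[OF int sm sn] by (simp add: has_bochner_integral_iff)
  moreover have "(\<Sum>n. integral\<^sup>L ?M (f n)) = Gamma \<gamma> * (t powr (\<gamma> + \<beta> - 1) * ml2 \<alpha> (\<gamma> + \<beta>) (c * t powr \<alpha>))"
  proof -
    have "(\<Sum>n. integral\<^sup>L ?M (f n)) =
      (\<Sum>n. Gamma \<gamma> * t powr (\<gamma> + \<beta> - 1) * ((c * t powr \<alpha>) ^ n / Gamma (\<alpha> * real n + (\<gamma> + \<beta>))))"
      using f by (simp add: has_bochner_integral_iff)
    also have "\<dots> = Gamma \<gamma> * t powr (\<gamma> + \<beta> - 1) * ml2 \<alpha> (\<gamma> + \<beta>) (c * t powr \<alpha>)"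
      unfolding ml2_def using assms by (intro suminf_mult ml2_summable) auto
    finally show ?thesis by simp
  qed
  ultimately show ?thesis
    by (simp only: has_bochner_integral_cong[OF refl eq refl])
qed

lemma ml2_convolution_has_integral:
  assumes "0 < \<alpha>" "0 < \<beta>" "0 < \<gamma>" "0 < t"
  shows "((\<lambda>s. (t - s) powr (\<gamma> - 1) * (s powr (\<beta> - 1) * ml2 \<alpha> \<beta> (c * s powr \<alpha>))) has_integral
      Gamma \<gamma> * (t powr (\<gamma> + \<beta> - 1) * ml2 \<alpha> (\<gamma> + \<beta>) (c * t powr \<alpha>))) {0..t}"
proof -
  have "((\<lambda>s. (t - s) powr (\<gamma> - 1) * (s powr (\<beta> - 1) * ml2 \<alpha> \<beta> (c * s powr \<alpha>))) has_integral
      Gamma \<gamma> * (t powr (\<gamma> + \<beta> - 1) * ml2 \<alpha> (\<gamma> + \<beta>) (c * t powr \<alpha>))) {0<..<t}"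
    using ml2_convolution[OF assms, of c] by (rule has_bochner_integral_lebesgue_onD) simp
  then show ?thesis by (simp add: has_integral_Icc_iff_Ioo)
qed

section \<open>Positivity of the relaxation kernel\<close>

text \<open>The kernel satisfies \<open>k = h - L (h * k)\<close>, where \<open>h t = t\<^sup>\<alpha>\<^sup>-\<^sup>1 / \<Gamma>(\<alpha>)\<close> and the star is
  convolution.\<close>

lemma ml2_kernel_volterra:
  fixes L :: real
  defines "k \<equiv> \<lambda>\<alpha> s. s powr (\<alpha> - 1) * ml2 \<alpha> \<alpha> (- L * s powr \<alpha>)"
  assumes "0 < \<alpha>" "0 < t" and I: "((\<lambda>s. (t - s) powr (\<alpha> - 1) * k \<alpha> s) has_integral I) {0..t}"
  shows "Gamma \<alpha> * k \<alpha> t = t powr (\<alpha> - 1) - L * I"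
proof -
  let ?J = "Gamma \<alpha> * (t powr (\<alpha> + \<alpha> - 1) * ml2 \<alpha> (\<alpha> + \<alpha>) (- L * t powr \<alpha>))"
  have "((\<lambda>s. (t - s) powr (\<alpha> - 1) * k \<alpha> s) has_integral ?J) {0..t}"
    unfolding k_def using assms by (intro ml2_convolution_has_integral)
  then have "I = ?J" using I by (rule has_integral_unique[rotated])
  have "t powr (\<alpha> + \<alpha> - 1) = t powr (\<alpha> - 1) * t powr \<alpha>" by (simp add: powr_add [symmetric])
  then have J: "L * ?J = - Gamma \<alpha> * (t powr (\<alpha> - 1) * (- L * t powr \<alpha> * ml2 \<alpha> (\<alpha> + \<alpha>) (- L * t powr \<alpha>)))"
    by simp
  have G: "Gamma \<alpha> > 0" using assms by auto
  have "k \<alpha> t = t powr (\<alpha> - 1) * (1 / Gamma \<alpha> + - L * t powr \<alpha> * ml2 \<alpha> (\<alpha> + \<alpha>) (- L * t powr \<alpha>))"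
    unfolding k_def using ml2_rec[of \<alpha> \<alpha> "- L * t powr \<alpha>"] assms by (simp only:)
  then have "Gamma \<alpha> * k \<alpha> t = t powr (\<alpha> - 1) - L * ?J"
    unfolding J using G by (simp add: field_simps)
  then show ?thesis using \<open>I = ?J\<close> by simp
qed

text \<open>Suppose that the kernel \<open>k\<close> of the preceding Volterra equation is positive before \<open>t0\<close> but not at
  \<open>t0\<close>. Since \<open>h\<close> is log-convex, \<open>h (t0 - s) / h (t1 - s)\<close> is nonincreasing in \<open>s\<close>, so the part of
  the memory term at time \<open>t0\<close> that stems from \<open>[0, t1]\<close> is at most \<open>h t0 / h t1\<close> times the
  memory term at time \<open>t1\<close>. Comparing the equations at the two times gives
  \<open>k t0 \<ge> (h t0 / h t1) k t1 - L \<integral> h (t0 - s) k s\<close>, the integral being taken over \<open>[t1, t0]\<close>.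
  If \<open>t1\<close> is close to \<open>t0\<close> and maximises \<open>k\<close> there, the integral is too small to make the right-hand
  side nonpositive. In the proof the factor \<open>1 / \<Gamma>(\<alpha>)\<close> is cleared from the equation and from \<open>h\<close>.\<close>

lemma ml2_pos:
  assumes \<alpha>: "0 < \<alpha>" "\<alpha> \<le> 1" and L: "0 \<le> L" and t: "0 \<le> t"
  shows "0 < ml2 \<alpha> \<alpha> (- L * t powr \<alpha>)"
proof (rule ccontr)
  assume neg: "\<not> 0 < ml2 \<alpha> \<alpha> (- L * t powr \<alpha>)"
  define e where "e s = ml2 \<alpha> \<alpha> (- L * s powr \<alpha>)" for s
  define k where "k s = s powr (\<alpha> - 1) * e s" for s
  define h where "h s = s powr (\<alpha> - 1)" for s :: real
  have G: "Gamma \<alpha> > 0" using \<alpha> by auto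
  have conte: "continuous_on {0..} e" unfolding e_def using \<alpha> by (intro continuous_on_ml2_powr)
  define S where "S = {s\<in>{0..t}. e s \<le> 0}"
  have "closed S" unfolding S_def
    by (intro continuous_on_closed_Collect_le continuous_intros continuous_on_subset[OF conte]) auto
  moreover have "bounded S" by (rule bounded_subset[of "{0..t}"]) (auto simp: S_def)
  ultimately have "compact S" by (simp add: compact_eq_bounded_closed)
  moreover have "t \<in> S" using neg t by (auto simp: S_def e_def)
  ultimately obtain t0 where t0S: "t0 \<in> S" and min: "\<And>s. s \<in> S \<Longrightarrow> t0 \<le> s"
    using compact_attains_inf[of S] by auto
  have "e 0 > 0" using \<alpha> G by (simp add: e_def)
  then have t0: "t0 > 0" using t0S by (cases "t0 = 0") (auto simp: S_def)
  have e0: "e t0 \<le> 0" using t0S by (simp add: S_def)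
  have epos: "e s > 0" if "0 \<le> s" "s < t0" for s
    using min[of s] that t0S by (force simp: S_def)
  have kpos: "k s > 0" if "0 < s" "s < t0" for s using epos[of s] that by (simp add: k_def)
  have k0: "k t0 \<le> 0" using e0 by (simp add: k_def mult_nonneg_nonpos)
  \<comment> \<open>The length \<open>d\<close> is chosen so that the memory of \<open>[t0 - d, t0]\<close> weighs less than half, while
    \<open>d \<le> t0 / 2\<close> makes \<open>h t0 / h t1\<close> at least one half.\<close>
  define x where "x = Gamma (\<alpha> + 1) / (2 * L + 2)"
  have G1: "Gamma (\<alpha> + 1) = \<alpha> * Gamma \<alpha>" using \<alpha> by (intro Gamma_plus1) (use nonpos_Ints_nonpos in force)
  have x: "x > 0" using \<alpha> L G by (simp add: x_def G1)
  define d where "d = min (t0 / 2) (x powr (1 / \<alpha>))"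
  have d: "0 < d" "d \<le> t0 / 2" using t0 x by (auto simp: d_def)
  have "d powr \<alpha> \<le> (x powr (1 / \<alpha>)) powr \<alpha>" using d \<alpha> by (intro powr_mono2) (auto simp: d_def)
  then have "d powr \<alpha> \<le> x" using \<alpha> x by (simp add: powr_powr)
  then have "L * d powr \<alpha> \<le> L * x" using L by (rule mult_left_mono)
  also have "L * x < \<alpha> * Gamma \<alpha> / 2"
  proof -
    have aG: "\<alpha> * Gamma \<alpha> > 0" using \<alpha> G by simp
    have "L * x = L / (2 * L + 2) * (\<alpha> * Gamma \<alpha>)" by (simp add: x_def G1)
    also have "\<dots> < 1 / 2 * (\<alpha> * Gamma \<alpha>)"
      using L aG by (intro mult_strict_right_mono) (auto simp: field_simps)
    finally show ?thesis by simp
  qed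
  finally have "L * d powr \<alpha> / \<alpha> < (\<alpha> * Gamma \<alpha> / 2) / \<alpha>" using \<alpha>(1) by (rule divide_strict_right_mono)
  then have Ld: "L * d powr \<alpha> / \<alpha> < Gamma \<alpha> / 2" using \<alpha> by simp
  have "continuous_on {t0 - d..t0} k" unfolding k_def using d t0
    by (intro continuous_intros continuous_on_subset[OF conte]) auto
  then obtain t1 where t1: "t1 \<in> {t0 - d..t0}" and max: "\<And>s. s \<in> {t0 - d..t0} \<Longrightarrow> k s \<le> k t1"
    using continuous_attains_sup[of "{t0 - d..t0}" k] d by auto
  have k1: "k t1 > 0" using kpos[of "t0 - d"] max[of "t0 - d"] d t0 by auto
  then have t1': "t1 < t0" using k0 t1 by (cases "t1 = t0") auto
  have t1p: "t1 > 0" "t0 / 2 \<le> t1" using t1 d t0 by auto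
  obtain I0 where I0: "((\<lambda>s. (t0 - s) powr (\<alpha> - 1) * k s) has_integral I0) {0..t0}"
    using ml2_convolution_has_integral[OF \<alpha>(1) \<alpha>(1) \<alpha>(1) t0, of "- L"] unfolding k_def e_def by blast
  obtain I1 where I1: "((\<lambda>s. (t1 - s) powr (\<alpha> - 1) * k s) has_integral I1) {0..t1}"
    using ml2_convolution_has_integral[OF \<alpha>(1) \<alpha>(1) \<alpha>(1) t1p(1), of "- L"] unfolding k_def e_def by blast
  have eq0: "Gamma \<alpha> * k t0 = h t0 - L * I0"
    using ml2_kernel_volterra[of \<alpha> t0 L I0] \<alpha> t0 I0 unfolding k_def e_def h_def by blast
  have eq1: "Gamma \<alpha> * k t1 = h t1 - L * I1"
    using ml2_kernel_volterra[of \<alpha> t1 L I1] \<alpha> t1p I1 unfolding k_def e_def h_def by blast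
  let ?F = "\<lambda>s. (t0 - s) powr (\<alpha> - 1) * k s"
  have F: "?F integrable_on {0..t0}" using I0 by auto
  have h: "h t1 > 0" "h t0 > 0" using t1p t0 by (auto simp: h_def)
  have "I0 = integral {0..t1} ?F + integral {t1..t0} ?F"
    using Henstock_Kurzweil_Integration.integral_combine[of 0 t1 t0 ?F] F t1p t1' integral_unique[OF I0] by simp
  moreover have "integral {0..t1} ?F \<le> h t0 / h t1 * I1"
  proof -
    have "?F integrable_on {0..t1}"
      using t1' by (intro integrable_on_subinterval[OF F]) simp
    then have "(?F has_integral integral {0..t1} ?F) {0..t1}" by (rule integrable_integral)
    then have a: "(?F has_integral integral {0..t1} ?F) {0<..<t1}" by (simp add: has_integral_Icc_iff_Ioo)
    have "((\<lambda>s. h t0 / h t1 * ((t1 - s) powr (\<alpha> - 1) * k s)) has_integral h t0 / h t1 * I1) {0..t1}"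
      using I1 by (rule has_integral_mult_right)
    then have b: "((\<lambda>s. h t0 / h t1 * ((t1 - s) powr (\<alpha> - 1) * k s)) has_integral h t0 / h t1 * I1) {0<..<t1}"
      by (simp add: has_integral_Icc_iff_Ioo)
    show ?thesis
    proof (rule has_integral_le[OF a b])
      fix s assume s: "s \<in> {0<..<t1}"
      have "s * t1 \<le> s * t0" using s t1' by (intro mult_left_mono) auto
      then have "t0 * (t1 - s) \<le> (t0 - s) * t1" by (simp add: algebra_simps)
      moreover have "0 < t0 * (t1 - s)" using s t0 by auto
      ultimately have "((t0 - s) * t1) powr (\<alpha> - 1) \<le> (t0 * (t1 - s)) powr (\<alpha> - 1)"
        using \<alpha> by (intro powr_mono2') auto
      then have "(t0 - s) powr (\<alpha> - 1) * h t1 \<le> h t0 * (t1 - s) powr (\<alpha> - 1)"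
        using s t1' t0 by (simp add: powr_mult h_def)
      then have "(t0 - s) powr (\<alpha> - 1) \<le> h t0 / h t1 * (t1 - s) powr (\<alpha> - 1)"
        using h by (simp add: field_simps)
      then have "(t0 - s) powr (\<alpha> - 1) * k s \<le> h t0 / h t1 * (t1 - s) powr (\<alpha> - 1) * k s"
        using kpos[of s] s t1' by (intro mult_right_mono) auto
      then show "?F s \<le> h t0 / h t1 * ((t1 - s) powr (\<alpha> - 1) * k s)" by simp
    qed
  qed
  moreover have "integral {t1..t0} ?F \<le> (t0 - t1) powr \<alpha> / \<alpha> * k t1"
  proof -
    have "?F integrable_on {t1..t0}"
      using t1p by (intro integrable_on_subinterval[OF F]) simp
    then have a: "(?F has_integral integral {t1..t0} ?F) {t1..t0}" by (rule integrable_integral)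
    have b: "((\<lambda>s. (t0 - s) powr (\<alpha> - 1) * k t1) has_integral (t0 - t1) powr \<alpha> / \<alpha> * k t1) {t1..t0}"
      using \<alpha> t1' by (intro has_integral_mult_left integral_powr_diff) auto
    show ?thesis
      by (rule has_integral_le[OF a b]) (use max t1 in \<open>auto intro!: mult_left_mono\<close>)
  qed
  moreover have "(t0 - t1) powr \<alpha> / \<alpha> * k t1 \<le> d powr \<alpha> / \<alpha> * k t1"
    using t1 t1' \<alpha> k1 by (intro mult_right_mono divide_right_mono powr_mono2) auto
  ultimately have "I0 \<le> h t0 / h t1 * I1 + d powr \<alpha> / \<alpha> * k t1" by linarith
  then have "L * I0 \<le> L * (h t0 / h t1 * I1 + d powr \<alpha> / \<alpha> * k t1)" using L by (rule mult_left_mono)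
  also have "\<dots> = h t0 / h t1 * (L * I1) + L * d powr \<alpha> / \<alpha> * k t1" by (simp add: algebra_simps)
  also have "L * I1 = h t1 - Gamma \<alpha> * k t1" using eq1 by simp
  also have "h t0 / h t1 * (h t1 - Gamma \<alpha> * k t1) = h t0 - h t0 / h t1 * (Gamma \<alpha> * k t1)"
    using h by (simp add: field_simps)
  finally have "h t0 / h t1 * (Gamma \<alpha> * k t1) - L * d powr \<alpha> / \<alpha> * k t1 \<le> Gamma \<alpha> * k t0"
    using eq0 by linarith
  also have "\<dots> \<le> 0" using k0 G by (simp add: mult_nonneg_nonpos)
  finally have A: "h t0 / h t1 * (Gamma \<alpha> * k t1) \<le> L * d powr \<alpha> / \<alpha> * k t1" by simp
  have "1 / 2 = (2::real) powr (-1)" by (simp add: powr_minus)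
  also have "\<dots> \<le> 2 powr (\<alpha> - 1)" using \<alpha> by (intro powr_mono) auto
  also have "\<dots> \<le> (t0 / t1) powr (\<alpha> - 1)" using \<alpha> t1p t0 by (intro powr_mono2') (auto simp: field_simps)
  also have "\<dots> = h t0 / h t1" using t1p t0 by (simp add: h_def powr_divide)
  finally have "1 / 2 * (Gamma \<alpha> * k t1) \<le> h t0 / h t1 * (Gamma \<alpha> * k t1)"
    using G k1 by (intro mult_right_mono) auto
  with A have "(Gamma \<alpha> / 2) * k t1 \<le> (L * d powr \<alpha> / \<alpha>) * k t1" by linarith
  moreover have "(L * d powr \<alpha> / \<alpha>) * k t1 < (Gamma \<alpha> / 2) * k t1"
    using Ld k1 by (rule mult_strict_right_mono)
  ultimately show False by linarith
qed

text \<open>In the Volterra equation the memory term enters with a negative sign, so a positive kernel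
  stays below the free term.\<close>

lemma ml2_le:
  assumes \<alpha>: "0 < \<alpha>" "\<alpha> \<le> 1" and L: "0 \<le> L" and t: "0 < t"
  shows "ml2 \<alpha> \<alpha> (- L * t powr \<alpha>) \<le> 1 / Gamma \<alpha>"
proof -
  obtain I where I: "((\<lambda>s. (t - s) powr (\<alpha> - 1) * (s powr (\<alpha> - 1) * ml2 \<alpha> \<alpha> (- L * s powr \<alpha>))) has_integral I) {0..t}"
    using ml2_convolution_has_integral[OF \<alpha>(1) \<alpha>(1) \<alpha>(1) t, of "- L"] by blast
  have "0 \<le> (t - s) powr (\<alpha> - 1) * (s powr (\<alpha> - 1) * ml2 \<alpha> \<alpha> (- L * s powr \<alpha>))" if "s \<in> {0..t}" for s
    using less_imp_le[OF ml2_pos[OF \<alpha> L, of s]] that by (intro mult_nonneg_nonneg) auto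
  with I have "I \<ge> 0" by (rule has_integral_nonneg)
  then have "0 \<le> L * I" using L by simp
  moreover have "Gamma \<alpha> * (t powr (\<alpha> - 1) * ml2 \<alpha> \<alpha> (- L * t powr \<alpha>)) = t powr (\<alpha> - 1) - L * I"
    by (rule ml2_kernel_volterra[OF \<alpha>(1) t I])
  ultimately have "Gamma \<alpha> * (t powr (\<alpha> - 1) * ml2 \<alpha> \<alpha> (- L * t powr \<alpha>)) \<le> t powr (\<alpha> - 1)"
    by linarith
  then have "t powr (\<alpha> - 1) * (Gamma \<alpha> * ml2 \<alpha> \<alpha> (- L * t powr \<alpha>)) \<le> t powr (\<alpha> - 1) * 1"
    by (simp add: mult_ac)
  moreover have "0 < t powr (\<alpha> - 1)" using t by simp
  ultimately have "Gamma \<alpha> * ml2 \<alpha> \<alpha> (- L * t powr \<alpha>) \<le> 1"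
    by (rule mult_left_le_imp_le)
  moreover have "Gamma \<alpha> > 0" using \<alpha> by simp
  ultimately show ?thesis by (simp add: pos_le_divide_eq mult.commute)
qed

text \<open>Both bounds express the function through integrals of the positive kernel: it is the fractional
  integral of order \<open>1 - \<alpha>\<close> (the kernel itself if \<open>\<alpha> = 1\<close>), and it is \<open>1\<close> minus \<open>L\<close> times the
  ordinary integral.\<close>

lemma mittag_leffler_bounds:
  assumes \<alpha>: "0 < \<alpha>" "\<alpha> \<le> 1" and L: "0 \<le> L" and t: "0 \<le> t"
  shows "0 \<le> mittag_leffler \<alpha> (- L * t powr \<alpha>)" "mittag_leffler \<alpha> (- L * t powr \<alpha>) \<le> (1::real)"
proof -
  have *: "0 \<le> mittag_leffler \<alpha> (- L * t powr \<alpha>) \<and> mittag_leffler \<alpha> (- L * t powr \<alpha>) \<le> (1::real)"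
  proof (cases "t = 0")
    case True
    then show ?thesis using \<alpha> by (simp add: mittag_leffler_conv_ml2)
  next
    case False
    then have t: "0 < t" using t by auto
    have kp: "0 \<le> s powr (\<alpha> - 1) * ml2 \<alpha> \<alpha> (- L * s powr \<alpha>)" if "s \<in> {0..t}" for s
      using less_imp_le[OF ml2_pos[OF \<alpha> L, of s]] that by (intro mult_nonneg_nonneg) auto
    have "0 \<le> Gamma 1 * (t powr (1 + \<alpha> - 1) * ml2 \<alpha> (1 + \<alpha>) (- L * t powr \<alpha>))"
      by (rule has_integral_nonneg[OF ml2_convolution_has_integral[OF \<alpha>(1) \<alpha>(1) zero_less_one t, of "- L"]])
        (use kp in auto)
    then have "0 \<le> ml2 \<alpha> (\<alpha> + 1) (- L * t powr \<alpha>)" using t by (simp add: zero_le_mult_iff add.commute)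
    then have "- L * t powr \<alpha> * ml2 \<alpha> (\<alpha> + 1) (- L * t powr \<alpha>) \<le> 0" using L
      by (simp add: mult_nonneg_nonneg)
    then have 1: "mittag_leffler \<alpha> (- L * t powr \<alpha>) \<le> (1::real)"
      using ml2_rec[OF \<alpha>(1) zero_less_one, of "- L * t powr \<alpha>"] by (simp add: mittag_leffler_conv_ml2)
    have "0 \<le> mittag_leffler \<alpha> (- L * t powr \<alpha>)"
    proof (cases "\<alpha> = 1")
      case True
      then show ?thesis using ml2_pos[OF \<alpha> L, of t] t by (simp add: mittag_leffler_conv_ml2)
    next
      case False
      then have a: "0 < 1 - \<alpha>" using \<alpha> by auto
      have "0 \<le> Gamma (1 - \<alpha>) * (t powr (1 - \<alpha> + \<alpha> - 1) * ml2 \<alpha> (1 - \<alpha> + \<alpha>) (- L * t powr \<alpha>))"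
        by (rule has_integral_nonneg[OF ml2_convolution_has_integral[OF \<alpha>(1) \<alpha>(1) a t, of "- L"]])
          (use kp in auto)
      moreover have "Gamma (1 - \<alpha>) > 0" using a by auto
      ultimately show ?thesis using t by (simp add: zero_le_mult_iff mittag_leffler_conv_ml2)
    qed
    with 1 show ?thesis by simp
  qed
  then show "0 \<le> mittag_leffler \<alpha> (- L * t powr \<alpha>)" "mittag_leffler \<alpha> (- L * t powr \<alpha>) \<le> (1::real)" by auto
qed

section \<open>The Caputo derivative\<close>

text \<open>On the open interval the one-sided derivative of the definition and \<open>deriv\<close> agree; the
  representative \<open>f'\<close> is in addition continuous up to \<open>T\<close>.\<close>

lemma W1E:
  assumes "f \<in> W1 T"
  obtains f' where "\<And>t. t \<in> {0<..<T} \<Longrightarrow> (f has_real_derivative f' t) (at t)"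
    "\<And>t. t \<in> {0<..<T} \<Longrightarrow> deriv f t = f' t"
    "continuous_on {0<..T} f'" "integrable (lebesgue_on {0<..<T}) f'"
proof -
  obtain f' where f': "\<And>t. t \<in> {0<..T} \<Longrightarrow> (f has_real_derivative f' t) (at t within {0<..T})" "continuous_on {0<..T} f'"
    using assms by (auto simp: W1_def Ball_def)
  have d: "(f has_real_derivative f' t) (at t)" if "t \<in> {0<..<T}" for t
  proof -
    have "at t within {0<..T} = at t" using that by (intro at_within_interior) auto
    then show ?thesis using f'(1)[of t] that by auto
  qed
  have e: "deriv f t = f' t" if "t \<in> {0<..<T}" for t using d[OF that] by (rule DERIV_imp_deriv)
  have "integrable (lebesgue_on {0<..<T}) (deriv f) \<longleftrightarrow> integrable (lebesgue_on {0<..<T}) f'"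
    using e by (intro Bochner_Integration.integrable_cong) auto
  then have "integrable (lebesgue_on {0<..<T}) f'" using assms by (simp add: W1_def)
  then show thesis using that d e f'(2) by blast
qed

lemma caputo_deriv_eq:
  assumes "\<alpha> < 1" "\<And>\<tau>. \<tau> \<in> {0<..<t} \<Longrightarrow> deriv f \<tau> = f' \<tau>"
  shows "caputo_deriv \<alpha> f t = 1 / Gamma (1 - \<alpha>) * (\<integral>\<tau>. (t - \<tau>) powr (1 - \<alpha> - 1) * f' \<tau> \<partial>lebesgue_on {0<..<t})"
proof -
  have "(\<integral>\<tau>. (t - \<tau>) powr (1 - \<alpha> - 1) * deriv f \<tau> \<partial>lebesgue_on {0<..<t}) =
      (\<integral>\<tau>. (t - \<tau>) powr (1 - \<alpha> - 1) * f' \<tau> \<partial>lebesgue_on {0<..<t})"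
    using assms(2) by (intro Bochner_Integration.integral_cong) auto
  then show ?thesis using assms(1) by (simp add: caputo_deriv_def RL_integral_def)
qed

text \<open>Each time factor has derivative \<open>- e i * k i\<close> with \<open>0 \<le> k i t \<le> t\<^sup>\<alpha>\<^sup>-\<^sup>1 / \<Gamma>(\<alpha>)\<close>. The bound does
  not depend on \<open>i\<close>, so summability of \<open>e i * a i\<close> controls the differentiated series uniformly away
  from \<open>0\<close>, and leaves only the integrable singularity \<open>t\<^sup>\<alpha>\<^sup>-\<^sup>1\<close> at \<open>0\<close>. In the Caputo derivative the
  \<open>i\<close>-th term contributes an integral of size at most \<open>\<Gamma>(1 - \<alpha>) \<bar>e i * a i\<bar>\<close>, so sum and integral may be
  interchanged.\<close>

lemma relaxation_superposition:
  fixes a e :: "nat \<Rightarrow> real"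
  assumes \<alpha>: "0 < \<alpha>" "\<alpha> \<le> 1" and e: "\<And>i. 0 \<le> e i"
    and sa: "summable (\<lambda>i. \<bar>a i\<bar>)" and sb: "summable (\<lambda>i. \<bar>e i * a i\<bar>)"
  defines "f \<equiv> \<lambda>t. \<Sum>i. a i * mittag_leffler \<alpha> (- e i * t powr \<alpha>)"
  shows "f \<in> W1 T"
    and "0 < t \<Longrightarrow> caputo_deriv \<alpha> f t = - (\<Sum>i. e i * a i * mittag_leffler \<alpha> (- e i * t powr \<alpha>))"
proof -
  define y where "y i t = mittag_leffler \<alpha> (- e i * t powr \<alpha>)" for i t
  define k where "k i t = t powr (\<alpha> - 1) * ml2 \<alpha> \<alpha> (- e i * t powr \<alpha>)" for i t
  define b where "b i = e i * a i" for i
  define f' where "f' t = (\<Sum>i. - b i * k i t)" for t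
  have sb': "summable (\<lambda>i. \<bar>b i\<bar>)" using sb by (simp add: b_def)
  have G: "Gamma \<alpha> > 0" using \<alpha> by simp
  have yb: "\<bar>y i t\<bar> \<le> 1" "0 \<le> y i t" if "0 \<le> t" for i t
    using mittag_leffler_bounds[OF \<alpha> e that, of i] by (auto simp: y_def)
  have kb: "0 \<le> k i t" "k i t \<le> t powr (\<alpha> - 1) / Gamma \<alpha>" if "0 < t" for i t
  proof -
    show "0 \<le> k i t" unfolding k_def using less_imp_le[OF ml2_pos[OF \<alpha> e, of t i]] that by simp
    have "k i t \<le> t powr (\<alpha> - 1) * (1 / Gamma \<alpha>)"
      unfolding k_def using ml2_le[OF \<alpha> e that, of i] by (rule mult_left_mono) simp
    then show "k i t \<le> t powr (\<alpha> - 1) / Gamma \<alpha>" by simp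
  qed
  have kc: "continuous_on {0<..} (k i)" for i
    unfolding k_def using \<alpha>
    by (intro continuous_intros continuous_on_subset[OF continuous_on_ml2_powr]) auto
  have dy: "((\<lambda>t. a i * y i t) has_real_derivative - b i * k i t) (at t)" if "0 < t" for i t
  proof -
    have "(y i has_real_derivative - e i * k i t) (at t)"
      unfolding y_def k_def using \<alpha>(1) that by (rule mittag_leffler_relaxation_has_derivative)
    from DERIV_cmult[OF this, of "a i"] show ?thesis by (simp add: b_def mult_ac)
  qed
  have sf: "summable (\<lambda>i. a i * y i t)" if "0 \<le> t" for t
  proof (rule summable_comparison_test'[OF sa])
    show "norm (a i * y i t) \<le> \<bar>a i\<bar>" for i
      using yb(1)[OF that, of i] by (simp add: abs_mult mult_left_le)
  qed
  have ub: "norm (- b i * k i t) \<le> \<bar>b i\<bar> * (\<delta> powr (\<alpha> - 1) / Gamma \<alpha>)" if "0 < \<delta>" "\<delta> \<le> t" for i t \<delta>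
  proof -
    have t: "0 < t" using that by simp
    have "k i t \<le> \<delta> powr (\<alpha> - 1) / Gamma \<alpha>"
      using kb(2)[OF t, of i] powr_mono2'[of "\<alpha> - 1" \<delta> t] that \<alpha> G
      by (smt (verit) divide_right_mono)
    then have "\<bar>b i\<bar> * k i t \<le> \<bar>b i\<bar> * (\<delta> powr (\<alpha> - 1) / Gamma \<alpha>)" by (rule mult_left_mono) simp
    then show ?thesis using kb(1)[OF t, of i] by (simp add: abs_mult)
  qed
  have unif: "uniform_limit {\<delta><..} (\<lambda>n t. \<Sum>i<n. - b i * k i t) f' sequentially" if "0 < \<delta>" for \<delta>
    unfolding f'_def
  proof (rule Weierstrass_m_test)
    show "norm (- b i * k i t) \<le> \<bar>b i\<bar> * (\<delta> powr (\<alpha> - 1) / Gamma \<alpha>)" if "t \<in> {\<delta><..}" for i t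
      using ub[OF \<open>0 < \<delta>\<close>, of t i] that by simp
    show "summable (\<lambda>i. \<bar>b i\<bar> * (\<delta> powr (\<alpha> - 1) / Gamma \<alpha>))" using sb' by (rule summable_mult2)
  qed
  have f_deriv: "(f has_real_derivative f' t) (at t)" if t: "0 < t" for t
    unfolding f_def f'_def y_def[symmetric]
  proof (rule has_field_derivative_series'(2)[of "{t/2<..}"])
    show "((\<lambda>t. a n * y n t) has_real_derivative - b n * k n s) (at s within {t / 2<..})" if "s \<in> {t / 2<..}" for n s
      by (rule has_field_derivative_at_within[OF dy]) (use that t in simp)
    show "uniformly_convergent_on {t/2<..} (\<lambda>n s. \<Sum>i<n. - b i * k i s)"
      using unif[of "t / 2"] t by (auto simp: uniformly_convergent_on_def)
    show "summable (\<lambda>n. a n * y n t)" using sf t by simp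
  qed (use t in \<open>auto simp: interior_open\<close>)
  have f'_cont: "continuous_on {0<..} f'"
  proof (rule continuous_at_imp_continuous_on, rule ballI)
    fix t :: real assume "t \<in> {0<..}"
    then have t: "0 < t" by simp
    have "continuous_on {t/2<..} f'"
      using t by (intro uniform_limit_theorem[OF _ unif] always_eventually allI)
        (auto intro!: continuous_intros continuous_on_subset[OF kc])
    then show "isCont f' t" using t by (simp add: continuous_on_eq_continuous_at)
  qed
  have f'_bound: "norm (f' t) \<le> (\<Sum>i. \<bar>b i\<bar>) / Gamma \<alpha> * t powr (\<alpha> - 1)" if "0 < t" for t
  proof -
    have "norm (f' t) \<le> (\<Sum>i. \<bar>b i\<bar> * (t powr (\<alpha> - 1) / Gamma \<alpha>))"
      unfolding f'_def using ub[OF that order_refl] sb' by (intro norm_suminf_le summable_mult2)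
    also have "\<dots> = (\<Sum>i. \<bar>b i\<bar>) * (t powr (\<alpha> - 1) / Gamma \<alpha>)"
      using sb' by (rule suminf_mult2 [symmetric])
    finally show ?thesis by simp
  qed
  have f'_int: "integrable (lebesgue_on {0<..<t}) f'" for t
  proof (cases "0 < t")
    case True
    \<comment> \<open>The Beta integral with first exponent \<open>0\<close> integrates the power \<open>s\<^sup>\<alpha>\<^sup>-\<^sup>1\<close>.\<close>
    have "has_bochner_integral (lebesgue_on {0<..<t}) (\<lambda>s. (t - s) powr (1 - 1) * s powr (\<alpha> - 1))
           (t powr (1 + \<alpha> - 1) * Gamma 1 * Gamma \<alpha> / Gamma (1 + \<alpha>))"
      using True \<alpha> by (intro has_bochner_integral_Beta) auto
    then have "integrable (lebesgue_on {0<..<t}) (\<lambda>s. (t - s) powr (1 - 1) * s powr (\<alpha> - 1))"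
      by (simp add: has_bochner_integral_iff)
    also have "?this \<longleftrightarrow> integrable (lebesgue_on {0<..<t}) (\<lambda>s. s powr (\<alpha> - 1))"
      by (intro Bochner_Integration.integrable_cong) auto
    finally have "integrable (lebesgue_on {0<..<t}) (\<lambda>s. (\<Sum>i. \<bar>b i\<bar>) / Gamma \<alpha> * s powr (\<alpha> - 1))"
      by (intro integrable_mult_right)
    then show ?thesis
    proof (rule Bochner_Integration.integrable_bound)
      show "f' \<in> borel_measurable (lebesgue_on {0<..<t})"
        by (intro continuous_imp_measurable_on_sets_lebesgue continuous_on_subset[OF f'_cont]) auto
      have "norm (f' s) \<le> norm ((\<Sum>i. \<bar>b i\<bar>) / Gamma \<alpha> * s powr (\<alpha> - 1))" if "0 < s" for s
        using f'_bound[OF that] by (rule order_trans) (simp only: real_norm_def abs_ge_self)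
      then show "AE s in lebesgue_on {0<..<t}. norm (f' s) \<le> norm ((\<Sum>i. \<bar>b i\<bar>) / Gamma \<alpha> * s powr (\<alpha> - 1))"
        by (intro AE_I2) (simp only: space_lebesgue_on greaterThanLessThan_iff)
    qed
  qed simp
  have f_deriv_eq: "deriv f t = f' t" if "0 < t" for t using f_deriv[OF that] by (rule DERIV_imp_deriv)
  show "f \<in> W1 T"
  proof -
    have "Ck_on 1 {0<..T} f"
      unfolding One_nat_def Ck_on.simps
      by (intro exI[of _ f'] conjI ballI f_deriv[THEN has_field_derivative_at_within] continuous_on_subset[OF f'_cont]) auto
    moreover have "integrable (lebesgue_on {0<..<T}) (deriv f) \<longleftrightarrow> integrable (lebesgue_on {0<..<T}) f'"
      using f_deriv_eq by (intro Bochner_Integration.integrable_cong) auto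
    ultimately show ?thesis using f'_int by (simp add: W1_def)
  qed
  assume t: "0 < t"
  show "caputo_deriv \<alpha> f t = - (\<Sum>i. e i * a i * mittag_leffler \<alpha> (- e i * t powr \<alpha>))"
  proof (cases "\<alpha> = 1")
    case True
    \<comment> \<open>The Caputo derivative is the ordinary one, and the kernel coincides with the relaxation function.\<close>
    have "f' t = (\<Sum>i. - (b i * y i t))"
      unfolding f'_def y_def k_def using t by (simp add: True mittag_leffler_conv_ml2)
    also have "\<dots> = - (\<Sum>i. b i * y i t)"
    proof (rule suminf_minus)
      show "summable (\<lambda>i. b i * y i t)"
        by (rule summable_comparison_test'[OF sb']) (use yb(1)[of t] t in \<open>auto simp: abs_mult mult_left_le\<close>)
    qed
    finally show ?thesis
      using f_deriv_eq[OF t] True by (simp add: caputo_deriv_def RL_integral_def b_def y_def)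
  next
    case False
    then have \<gamma>: "0 < 1 - \<alpha>" "\<alpha> < 1" using \<alpha> by auto
    have G1: "Gamma (1 - \<alpha>) > 0" using \<gamma> by simp
    let ?M = "lebesgue_on {0<..<t}"
    define w where "w i s = (t - s) powr (1 - \<alpha> - 1) * k i s" for i s
    have w: "has_bochner_integral ?M (w i) (Gamma (1 - \<alpha>) * y i t)" for i
    proof -
      have "has_bochner_integral ?M (w i) (Gamma (1 - \<alpha>) * (t powr (1 - \<alpha> + \<alpha> - 1) * ml2 \<alpha> (1 - \<alpha> + \<alpha>) (- e i * t powr \<alpha>)))"
        unfolding w_def k_def using \<alpha>(1) \<gamma>(1) t by (intro ml2_convolution)
      then show ?thesis using t by (simp add: y_def mittag_leffler_conv_ml2)
    qed
    have wi: "integrable ?M (w i)" and wI: "integral\<^sup>L ?M (w i) = Gamma (1 - \<alpha>) * y i t" for i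
      using w[of i] by (auto simp: has_bochner_integral_iff)
    have w0: "0 \<le> w i s" if "s \<in> {0<..<t}" for i s
      unfolding w_def using kb(1)[of s i] that by simp
    have int: "integrable ?M (\<lambda>s. - b i * w i s)" for i using wi by simp
    have nI: "(\<integral>s. norm (- b i * w i s) \<partial>?M) = \<bar>b i\<bar> * (Gamma (1 - \<alpha>) * y i t)" for i
    proof -
      have "(\<integral>s. norm (- b i * w i s) \<partial>?M) = (\<integral>s. \<bar>b i\<bar> * w i s \<partial>?M)"
        using w0 by (intro Bochner_Integration.integral_cong) (auto simp: abs_mult)
      then show ?thesis using wI by simp
    qed
    have sm: "AE s in ?M. summable (\<lambda>i. norm (- b i * w i s))"
    proof (rule AE_I2)
      fix s assume "s \<in> space ?M"
      then have s: "0 < s" by auto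
      show "summable (\<lambda>i. norm (- b i * w i s))"
      proof (rule summable_comparison_test')
        show "summable (\<lambda>i. (t - s) powr (1 - \<alpha> - 1) * (\<bar>b i\<bar> * (s powr (\<alpha> - 1) / Gamma \<alpha>)))"
          using sb' by (intro summable_mult summable_mult2)
        fix i
        have "norm (- b i * w i s) = (t - s) powr (1 - \<alpha> - 1) * norm (- b i * k i s)"
          by (simp add: w_def abs_mult)
        also have "\<dots> \<le> (t - s) powr (1 - \<alpha> - 1) * (\<bar>b i\<bar> * (s powr (\<alpha> - 1) / Gamma \<alpha>))"
          using ub[OF s order_refl] by (rule mult_left_mono) simp
        finally show "norm (norm (- b i * w i s)) \<le> (t - s) powr (1 - \<alpha> - 1) * (\<bar>b i\<bar> * (s powr (\<alpha> - 1) / Gamma \<alpha>))"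
          by simp
      qed
    qed
    have sn: "summable (\<lambda>i. \<integral>s. norm (- b i * w i s) \<partial>?M)"
      unfolding nI
    proof (rule summable_comparison_test')
      show "summable (\<lambda>i. Gamma (1 - \<alpha>) * \<bar>b i\<bar>)" using sb' by (rule summable_mult)
      show "norm (\<bar>b i\<bar> * (Gamma (1 - \<alpha>) * y i t)) \<le> Gamma (1 - \<alpha>) * \<bar>b i\<bar>" for i
        using yb[of t i] t G1 by (simp add: abs_mult mult_left_le mult_left_mono mult.commute)
    qed
    have "(\<integral>s. (t - s) powr (1 - \<alpha> - 1) * f' s \<partial>?M) = (\<integral>s. (\<Sum>i. - b i * w i s) \<partial>?M)"
    proof (rule Bochner_Integration.integral_cong[OF refl])
      fix s assume "s \<in> space ?M"
      then have s: "0 < s" by auto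
      have "summable (\<lambda>i. - b i * k i s)"
        by (rule summable_comparison_test'[OF summable_mult2[OF sb', of "s powr (\<alpha> - 1) / Gamma \<alpha>"]])
          (rule ub[OF s order_refl])
      from suminf_mult[OF this, of "(t - s) powr (1 - \<alpha> - 1)"]
      show "(t - s) powr (1 - \<alpha> - 1) * f' s = (\<Sum>i. - b i * w i s)"
        unfolding f'_def w_def by (simp add: mult_ac)
    qed
    also have "\<dots> = (\<Sum>i. \<integral>s. - b i * w i s \<partial>?M)" by (rule integral_suminf[OF int sm sn])
    also have "\<dots> = (\<Sum>i. - Gamma (1 - \<alpha>) * (b i * y i t))" using wI by (simp add: mult_ac)
    also have "\<dots> = - Gamma (1 - \<alpha>) * (\<Sum>i. b i * y i t)"
    proof (rule suminf_mult)
      show "summable (\<lambda>i. b i * y i t)"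
        by (rule summable_comparison_test'[OF sb']) (use yb(1)[of t] t in \<open>auto simp: abs_mult mult_left_le\<close>)
    qed
    finally have "(\<integral>s. (t - s) powr (1 - \<alpha> - 1) * f' s \<partial>?M) = - Gamma (1 - \<alpha>) * (\<Sum>i. b i * y i t)" .
    moreover have "caputo_deriv \<alpha> f t = 1 / Gamma (1 - \<alpha>) * (\<integral>s. (t - s) powr (1 - \<alpha> - 1) * f' s \<partial>?M)"
      using f_deriv_eq by (intro caputo_deriv_eq \<gamma>) auto
    ultimately show ?thesis using G1 by (simp add: b_def y_def)
  qed
qed

text \<open>With \<open>f t - f \<tau> \<ge> 0\<close>, integration by parts on \<open>[0, s]\<close> produces a nonnegative integral, a
  nonnegative boundary term at \<open>0\<close>, and a boundary term at \<open>s\<close> of size \<open>O((t - s)\<^sup>\<gamma>)\<close>, because \<open>f\<close> is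
  Lipschitz near \<open>t\<close>. The latter disappears as \<open>s \<rightarrow> t\<close>.\<close>

lemma caputo_extremum_principle:
  fixes f f' :: "real \<Rightarrow> real"
  assumes \<gamma>: "0 < \<gamma>" "\<gamma> < 1" and t: "0 < t" and int: "integrable (lebesgue_on {0<..<t}) f'"
    and cont: "continuous_on {0<..t} f'" and f: "continuous_on {0..t} f"
    and deriv: "\<And>\<tau>. \<tau> \<in> {0<..<t} \<Longrightarrow> (f has_real_derivative f' \<tau>) (at \<tau>)"
    and max: "\<And>\<tau>. \<tau> \<in> {0..t} \<Longrightarrow> f \<tau> \<le> f t"
  shows "0 \<le> (\<integral>\<tau>. (t - \<tau>) powr (\<gamma> - 1) * f' \<tau> \<partial>lebesgue_on {0<..<t})"
proof -
  let ?F = "\<lambda>\<tau>. (t - \<tau>) powr (\<gamma> - 1) * f' \<tau>"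
  have F: "(?F has_integral (\<integral>\<tau>. ?F \<tau> \<partial>lebesgue_on {0<..<t})) {0..t}"
    using weakly_singular_integrable[OF \<gamma>(1) _ t int cont] \<gamma> by (intro has_integral_Icc_lebesgue_on_Ioo) auto
  have "compact (f' ` {t/2..t})"
    using t by (intro compact_continuous_image continuous_on_subset[OF cont]) auto
  then obtain K where K: "K > 0" "\<forall>y\<in>f' ` {t/2..t}. norm y \<le> K"
    using compact_imp_bounded bounded_pos by blast
  define J where "J s = integral {0..s} ?F" for s
  have Jc: "continuous_on {0..t} J" unfolding J_def
    using F by (intro indefinite_integral_continuous_1) auto
  have key: "0 \<le> J s + K * (t - s) powr \<gamma>" if s: "s \<in> {t/2<..<t}" for s
  proof -
    have s0: "0 < s" "s < t" using s t by auto
    have g: "f t - f s \<le> K * (t - s)"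
    proof -
      have "\<exists>D z. s < z \<and> z < t \<and> (f has_real_derivative D) (at z) \<and> f t - f s = (t - s) * D"
      proof (rule MVT)
        show "f differentiable (at z)" if "s < z" "z < t" for z
          using deriv[of z] that s0 by (auto simp: real_differentiable_def)
      qed (use s0 in \<open>auto intro: continuous_on_subset[OF f]\<close>)
      then obtain D z where z: "s < z" "z < t" "(f has_real_derivative D) (at z)" "f t - f s = (t - s) * D"
        by blast
      moreover from this have "D = f' z" using deriv[of z] s0 by (auto intro: DERIV_unique)
      ultimately have z: "s < z" "z < t" "f t - f s = (t - s) * f' z" by auto
      then have "z \<in> {t/2..t}" using s by auto
      then have "norm (f' z) \<le> K" using K(2) by blast
      then have "f' z \<le> K" by simp
      then show ?thesis using z(3) s0 by (simp add: mult.commute mult_left_mono)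
    qed
    \<comment> \<open>The derivative of \<open>- (t - \<tau>)\<^sup>\<gamma>\<^sup>-\<^sup>1 (f t - f \<tau>)\<close>.\<close>
    let ?G = "\<lambda>\<tau>. (t - \<tau>) powr (\<gamma> - 1) * f' \<tau> - (1 - \<gamma>) * (t - \<tau>) powr (\<gamma> - 2) * (f t - f \<tau>)"
    have G: "(?G has_integral (- ((t - s) powr (\<gamma> - 1) * (f t - f s)) - - ((t - 0) powr (\<gamma> - 1) * (f t - f 0)))) {0..s}"
    proof (rule fundamental_theorem_of_calculus_interior)
      show "continuous_on {0..s} (\<lambda>\<tau>. - ((t - \<tau>) powr (\<gamma> - 1) * (f t - f \<tau>)))"
        using s0 by (intro continuous_intros continuous_on_subset[OF f]) auto
      fix \<tau> assume \<tau>: "\<tau> \<in> {0<..<s}"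
      then have d: "(f has_real_derivative f' \<tau>) (at \<tau>)" using deriv s0 by auto
      have "((\<lambda>\<tau>. (t - \<tau>) powr (\<gamma> - 1)) has_real_derivative - ((\<gamma> - 1) * (t - \<tau>) powr (\<gamma> - 2))) (at \<tau>)"
        using \<tau> s0 by (auto intro!: derivative_eq_intros)
      moreover have "((\<lambda>\<tau>. f t - f \<tau>) has_real_derivative - f' \<tau>) (at \<tau>)"
        using d by (auto intro!: derivative_eq_intros)
      ultimately have "((\<lambda>\<tau>. (t - \<tau>) powr (\<gamma> - 1) * (f t - f \<tau>)) has_real_derivative
          ((t - \<tau>) powr (\<gamma> - 1) * (- f' \<tau>) + - ((\<gamma> - 1) * (t - \<tau>) powr (\<gamma> - 2)) * (f t - f \<tau>))) (at \<tau>)"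
        by (rule DERIV_mult')
      from DERIV_minus[OF this]
      show "((\<lambda>\<tau>. - ((t - \<tau>) powr (\<gamma> - 1) * (f t - f \<tau>))) has_vector_derivative ?G \<tau>) (at \<tau>)"
        by (simp add: has_real_derivative_iff_has_vector_derivative algebra_simps)
    qed (use s0 in auto)
    moreover have J: "(?F has_integral J s) {0..s}"
    proof -
      have "?F integrable_on {0..t}" using F by (rule has_integral_integrable)
      then have "?F integrable_on {0..s}" by (rule integrable_on_subinterval) (use s0 in auto)
      then show ?thesis unfolding J_def by (rule integrable_integral)
    qed
    moreover have "?G \<tau> \<le> ?F \<tau>" if "\<tau> \<in> {0..s}" for \<tau>
    proof -
      have "0 \<le> (1 - \<gamma>) * (t - \<tau>) powr (\<gamma> - 2) * (f t - f \<tau>)"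
        using \<gamma> max[of \<tau>] that s0 by (intro mult_nonneg_nonneg) auto
      then show ?thesis by linarith
    qed
    ultimately have "- ((t - s) powr (\<gamma> - 1) * (f t - f s)) - - ((t - 0) powr (\<gamma> - 1) * (f t - f 0)) \<le> J s"
      using has_integral_le[OF G J] by blast
    moreover have "0 \<le> (t - 0) powr (\<gamma> - 1) * (f t - f 0)" using max[of 0] t by auto
    moreover have "(t - s) powr (\<gamma> - 1) * (f t - f s) \<le> (t - s) powr (\<gamma> - 1) * (K * (t - s))"
      using g by (rule mult_left_mono) auto
    moreover have "(t - s) powr (\<gamma> - 1) * (K * (t - s)) = K * (t - s) powr \<gamma>"
      using s0 by (simp add: powr_diff)
    ultimately show ?thesis by linarith
  qed
  have cl: "closure {t/2<..<t} = {t/2..t}" using t by simp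
  have "0 \<le> J t + K * (t - t) powr \<gamma>"
  proof (rule continuous_ge_on_closure[where S = "{t/2<..<t}" and f = "\<lambda>s. J s + K * (t - s) powr \<gamma>" and x = t])
    show "continuous_on (closure {t/2<..<t}) (\<lambda>s. J s + K * (t - s) powr \<gamma>)"
      unfolding cl using t \<gamma>
      by (intro continuous_intros continuous_on_powr' continuous_on_subset[OF Jc]) auto
  qed (use key cl t in auto)
  then have "0 \<le> J t" by simp
  then show ?thesis using F by (simp add: J_def integral_unique)
qed

text \<open>The extremum principle for \<open>v - w - \<epsilon> \<tau>\<close>; the linear term, whose Caputo derivative is
  positive, makes the inequality strict.\<close>

lemma caputo_deriv_less_at_max:
  fixes v w :: "real \<Rightarrow> real"
  assumes \<alpha>: "0 < \<alpha>" "\<alpha> \<le> 1" and \<epsilon>: "0 < \<epsilon>" and t: "0 < t" "t < T"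
    and v: "v \<in> W1 T" "continuous_on {0..t} v" and w: "w \<in> W1 T" "continuous_on {0..t} w"
    and max: "\<And>\<tau>. \<tau> \<in> {0..t} \<Longrightarrow> v \<tau> - w \<tau> - \<epsilon> * \<tau> \<le> v t - w t - \<epsilon> * t"
  shows "caputo_deriv \<alpha> w t < caputo_deriv \<alpha> v t"
proof -
  obtain v' where v': "\<And>t. t \<in> {0<..<T} \<Longrightarrow> (v has_real_derivative v' t) (at t)"
    "\<And>t. t \<in> {0<..<T} \<Longrightarrow> deriv v t = v' t"
    "continuous_on {0<..T} v'" "integrable (lebesgue_on {0<..<T}) v'" using W1E[OF v(1)] by blast
  obtain w' where w': "\<And>t. t \<in> {0<..<T} \<Longrightarrow> (w has_real_derivative w' t) (at t)"
    "\<And>t. t \<in> {0<..<T} \<Longrightarrow> deriv w t = w' t"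
    "continuous_on {0<..T} w'" "integrable (lebesgue_on {0<..<T}) w'" using W1E[OF w(1)] by blast
  define f where "f \<tau> = v \<tau> - w \<tau> - \<epsilon> * \<tau>" for \<tau>
  define f' where "f' \<tau> = v' \<tau> - w' \<tau> - \<epsilon>" for \<tau>
  have df: "(f has_real_derivative f' \<tau>) (at \<tau>)" if "\<tau> \<in> {0<..<T}" for \<tau>
    unfolding f_def f'_def using v'(1)[OF that] w'(1)[OF that] by (auto intro!: derivative_eq_intros)
  show ?thesis
  proof (cases "\<alpha> = 1")
    case True
    have "0 \<le> f' t"
    proof (rule ccontr)
      assume "\<not> 0 \<le> f' t"
      then obtain d where d: "d > 0" "\<And>h. 0 < h \<Longrightarrow> h < d \<Longrightarrow> f t < f (t - h)"
        using DERIV_neg_dec_left[OF df[of t]] t by auto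
      have "f t < f (t - min (d / 2) t)" using d t by (intro d(2)) auto
      moreover have "f (t - min (d / 2) t) \<le> f t" unfolding f_def using d t by (intro max) auto
      ultimately show False by simp
    qed
    then show ?thesis using True v'(2)[of t] w'(2)[of t] t \<epsilon>
      by (simp add: caputo_deriv_def RL_integral_def f'_def)
  next
    case False
    then have g: "0 < 1 - \<alpha>" "1 - \<alpha> < 1" "\<alpha> < 1" using \<alpha> by auto
    let ?M = "lebesgue_on {0<..<t}"
    define k where "k \<tau> = (t - \<tau>) powr (1 - \<alpha> - 1)" for \<tau>
    have int: "integrable ?M v'" "integrable ?M w'"
      using t by (auto intro: integrable_lebesgue_on_subset[OF v'(4)] integrable_lebesgue_on_subset[OF w'(4)])
    have ct: "continuous_on {0<..t} v'" "continuous_on {0<..t} w'"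
      using t by (auto intro: continuous_on_subset[OF v'(3)] continuous_on_subset[OF w'(3)])
    have one: "integrable ?M (\<lambda>_. \<epsilon>)" by (intro integrable_lebesgue_on_Ioo_continuous continuous_intros)
    have kv: "integrable ?M (\<lambda>\<tau>. k \<tau> * v' \<tau>)" and kw: "integrable ?M (\<lambda>\<tau>. k \<tau> * w' \<tau>)"
      and ke: "integrable ?M (\<lambda>\<tau>. k \<tau> * \<epsilon>)"
      unfolding k_def
      by (rule weakly_singular_integrable; use g t int ct one in \<open>simp add: continuous_on_const\<close>)+
    have "0 \<le> (\<integral>\<tau>. k \<tau> * f' \<tau> \<partial>?M)" unfolding k_def
    proof (rule caputo_extremum_principle[OF g(1,2) t(1)])
      show "integrable ?M f'" unfolding f'_def using int one by auto
      show "continuous_on {0<..t} f'" unfolding f'_def using ct by (auto intro!: continuous_intros)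
      show "continuous_on {0..t} f" unfolding f_def using v w by (auto intro!: continuous_intros)
      show "(f has_real_derivative f' \<tau>) (at \<tau>)" if "\<tau> \<in> {0<..<t}" for \<tau> using df that t by auto
      show "f \<tau> \<le> f t" if "\<tau> \<in> {0..t}" for \<tau> unfolding f_def using that by (rule max)
    qed
    also have "(\<integral>\<tau>. k \<tau> * f' \<tau> \<partial>?M) = (\<integral>\<tau>. k \<tau> * v' \<tau> - k \<tau> * w' \<tau> - k \<tau> * \<epsilon> \<partial>?M)"
      by (simp add: f'_def algebra_simps)
    also have "\<dots> = (\<integral>\<tau>. k \<tau> * v' \<tau> \<partial>?M) - (\<integral>\<tau>. k \<tau> * w' \<tau> \<partial>?M) - (\<integral>\<tau>. k \<tau> * \<epsilon> \<partial>?M)"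
      using kv kw ke by (simp add: Bochner_Integration.integral_diff Bochner_Integration.integrable_diff del: Bochner_Integration.integral_mult_left)
    finally have "(\<integral>\<tau>. k \<tau> * w' \<tau> \<partial>?M) + (\<integral>\<tau>. k \<tau> * \<epsilon> \<partial>?M) \<le> (\<integral>\<tau>. k \<tau> * v' \<tau> \<partial>?M)" by linarith
    moreover have "0 < (\<integral>\<tau>. k \<tau> * \<epsilon> \<partial>?M)"
    proof -
      have "((\<lambda>s. k s * \<epsilon>) has_integral (t - 0) powr (1 - \<alpha>) / (1 - \<alpha>) * \<epsilon>) {0..t}"
        unfolding k_def using g t by (intro has_integral_mult_left integral_powr_diff) auto
      then have "(\<integral>\<tau>. k \<tau> * \<epsilon> \<partial>?M) = (t - 0) powr (1 - \<alpha>) / (1 - \<alpha>) * \<epsilon>"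
        using has_integral_Icc_lebesgue_on_Ioo[OF ke] has_integral_unique by blast
      then show ?thesis using t g \<epsilon> by simp
    qed
    ultimately have "(\<integral>\<tau>. k \<tau> * w' \<tau> \<partial>?M) < (\<integral>\<tau>. k \<tau> * v' \<tau> \<partial>?M)" by linarith
    moreover have "caputo_deriv \<alpha> v t = 1 / Gamma (1 - \<alpha>) * (\<integral>\<tau>. k \<tau> * v' \<tau> \<partial>?M)"
      unfolding k_def using v'(2) t by (intro caputo_deriv_eq g) auto
    moreover have "caputo_deriv \<alpha> w t = 1 / Gamma (1 - \<alpha>) * (\<integral>\<tau>. k \<tau> * w' \<tau> \<partial>?M)"
      unfolding k_def using w'(2) t by (intro caputo_deriv_eq g) auto
    moreover have "0 < 1 / Gamma (1 - \<alpha>)" using g by simp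
    ultimately show ?thesis by (simp only: mult_less_cancel_left_pos)
  qed
qed

section \<open>Square-integrable functions and Bessel's inequality\<close>

lemma L2_cong:
  assumes "f \<in> L2 l" "\<And>x. x \<in> {0<..<l} \<Longrightarrow> f x = g x"
  shows "g \<in> L2 l"
proof -
  have "f \<in> borel_measurable (lebesgue_on {0<..<l}) \<longleftrightarrow> g \<in> borel_measurable (lebesgue_on {0<..<l})"
    using assms(2) by (intro measurable_cong) auto
  moreover have "integrable (lebesgue_on {0<..<l}) (\<lambda>x. (f x)\<^sup>2) \<longleftrightarrow> integrable (lebesgue_on {0<..<l}) (\<lambda>x. (g x)\<^sup>2)"
    using assms(2) by (intro Bochner_Integration.integrable_cong) auto
  ultimately show ?thesis using assms(1) by (simp add: L2_def)
qed

lemma L2_mult_integrable: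
  assumes "f \<in> L2 l" "g \<in> L2 l"
  shows "integrable (lebesgue_on {0<..<l}) (\<lambda>x. f x * g x)"
proof (rule Bochner_Integration.integrable_bound)
  show "integrable (lebesgue_on {0<..<l}) (\<lambda>x. (f x)\<^sup>2 + (g x)\<^sup>2)"
    using assms by (auto simp: L2_def)
  show "(\<lambda>x. f x * g x) \<in> borel_measurable (lebesgue_on {0<..<l})"
    using assms by (auto simp: L2_def)
  have "\<bar>a * b\<bar> \<le> a\<^sup>2 + b\<^sup>2" for a b :: real
  proof -
    have "0 \<le> (\<bar>a\<bar> - \<bar>b\<bar>)\<^sup>2" by simp
    then have "2 * (\<bar>a\<bar> * \<bar>b\<bar>) \<le> a\<^sup>2 + b\<^sup>2" by (simp add: power2_diff)
    moreover have "0 \<le> \<bar>a\<bar> * \<bar>b\<bar>" by simp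
    ultimately show ?thesis unfolding abs_mult by linarith
  qed
  then show "AE x in lebesgue_on {0<..<l}. norm (f x * g x) \<le> norm ((f x)\<^sup>2 + (g x)\<^sup>2)"
    by simp
qed

lemma L2_add:
  assumes "f \<in> L2 l" "g \<in> L2 l"
  shows "(\<lambda>x. f x + g x) \<in> L2 l"
proof -
  have "integrable (lebesgue_on {0<..<l}) (\<lambda>x. (f x)\<^sup>2 + (g x)\<^sup>2 + 2 * (f x * g x))"
    using assms L2_mult_integrable[OF assms] by (intro Bochner_Integration.integrable_add) (auto simp: L2_def)
  then have "integrable (lebesgue_on {0<..<l}) (\<lambda>x. (f x + g x)\<^sup>2)"
    by (simp add: power2_sum mult.assoc)
  then show ?thesis using assms by (auto simp: L2_def)
qed

lemma L2_cmult: "f \<in> L2 l \<Longrightarrow> (\<lambda>x. c * f x) \<in> L2 l"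
  by (auto simp: L2_def power_mult_distrib)

lemma L2_sum: "(\<And>i. i \<in> I \<Longrightarrow> f i \<in> L2 l) \<Longrightarrow> (\<lambda>x. \<Sum>i\<in>I. f i x) \<in> L2 l"
proof (induction I rule: infinite_finite_induct)
  case (insert a I)
  then show ?case using L2_add[of "f a" l "\<lambda>x. \<Sum>i\<in>I. f i x"] by simp
qed (simp_all add: L2_def)

lemma L2_continuous:
  assumes "continuous_on {0..l} f"
  shows "f \<in> L2 l"
proof -
  have "integrable (lebesgue_on {0<..<l}) f" using assms by (rule integrable_lebesgue_on_Ioo_continuous)
  moreover have "integrable (lebesgue_on {0<..<l}) (\<lambda>x. (f x)\<^sup>2)"
    using assms by (intro integrable_lebesgue_on_Ioo_continuous continuous_intros)
  ultimately show ?thesis by (simp add: L2_def borel_measurable_integrable)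
qed

lemma L2_inner_commute: "L2_inner l f g = L2_inner l g f"
  by (simp add: L2_inner_def mult.commute)

lemma L2_inner_cmult_left: "L2_inner l (\<lambda>x. c * f x) g = c * L2_inner l f g"
  by (simp add: L2_inner_def mult.assoc)

lemma L2_inner_sum_left:
  assumes "\<And>i. i \<in> I \<Longrightarrow> f i \<in> L2 l" "h \<in> L2 l"
  shows "L2_inner l (\<lambda>x. \<Sum>i\<in>I. f i x) h = (\<Sum>i\<in>I. L2_inner l (f i) h)"
  using assms unfolding L2_inner_def sum_distrib_right
  by (intro Bochner_Integration.integral_sum L2_mult_integrable) auto

lemma L2_inner_add_left:
  assumes "f \<in> L2 l" "g \<in> L2 l" "h \<in> L2 l"
  shows "L2_inner l (\<lambda>x. f x + g x) h = L2_inner l f h + L2_inner l g h"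
  using assms by (simp add: L2_inner_def distrib_right L2_mult_integrable)

lemma L2_inner_lincomb_orthonormal:
  assumes "orthonormal_L2 l X" "finite I"
  shows "L2_inner l (\<lambda>x. \<Sum>i\<in>I. a i * X i x) (\<lambda>x. \<Sum>i\<in>I. b i * X i x) = (\<Sum>i\<in>I. a i * b i)"
proof -
  have X: "X i \<in> L2 l" for i using assms by (simp add: orthonormal_L2_def)
  have "L2_inner l (\<lambda>x. \<Sum>i\<in>I. a i * X i x) (\<lambda>x. \<Sum>i\<in>I. b i * X i x) =
     (\<Sum>i\<in>I. a i * L2_inner l (X i) (\<lambda>x. \<Sum>j\<in>I. b j * X j x))"
    using X by (subst L2_inner_sum_left) (auto intro!: L2_sum L2_cmult simp: L2_inner_cmult_left)
  also have "\<dots> = (\<Sum>i\<in>I. a i * (\<Sum>j\<in>I. b j * L2_inner l (X j) (X i)))"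
    using X by (subst L2_inner_commute, subst L2_inner_sum_left)
      (auto intro!: L2_sum L2_cmult simp: L2_inner_cmult_left)
  also have "\<dots> = (\<Sum>i\<in>I. a i * b i)"
  proof (rule sum.cong[OF refl])
    fix i assume i: "i \<in> I"
    have "(\<Sum>j\<in>I. b j * L2_inner l (X j) (X i)) = (\<Sum>j\<in>I. if j = i then b i else 0)"
      using assms by (intro sum.cong) (auto simp: orthonormal_L2_def)
    then show "a i * (\<Sum>j\<in>I. b j * L2_inner l (X j) (X i)) = a i * b i"
      using i assms by simp
  qed
  finally show ?thesis .
qed

text \<open>The squared distance of \<open>f\<close> from its projection is nonnegative.\<close>

lemma bessel_inequality:
  assumes X: "orthonormal_L2 l X" and f: "f \<in> L2 l" and I: "finite I"
  shows "(\<Sum>i\<in>I. (L2_inner l f (X i))\<^sup>2) \<le> L2_inner l f f"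
proof -
  have X2: "X i \<in> L2 l" for i using X by (simp add: orthonormal_L2_def)
  define c where "c i = L2_inner l f (X i)" for i
  define S where "S x = (\<Sum>i\<in>I. c i * X i x)" for x
  have S: "S \<in> L2 l" unfolding S_def using X2 by (intro L2_sum L2_cmult)
  have SS: "L2_inner l S S = (\<Sum>i\<in>I. (c i)\<^sup>2)"
    unfolding S_def L2_inner_lincomb_orthonormal[OF X I] by (simp add: power2_eq_square)
  have Sf: "L2_inner l S f = (\<Sum>i\<in>I. (c i)\<^sup>2)"
    unfolding S_def using X2 f by (subst L2_inner_sum_left)
      (auto intro!: L2_cmult sum.cong simp: L2_inner_cmult_left c_def L2_inner_commute[of l _ f] power2_eq_square)
  have "0 \<le> (\<integral>x. (f x - S x)\<^sup>2 \<partial>lebesgue_on {0<..<l})" by simp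
  also have "(\<lambda>x. (f x - S x)\<^sup>2) = (\<lambda>x. f x * f x - 2 * (S x * f x) + S x * S x)"
    by (simp add: power2_eq_square algebra_simps fun_eq_iff)
  also have "(\<integral>x. f x * f x - 2 * (S x * f x) + S x * S x \<partial>lebesgue_on {0<..<l}) =
      L2_inner l f f - 2 * L2_inner l S f + L2_inner l S S"
    unfolding L2_inner_def using L2_mult_integrable[OF f f] L2_mult_integrable[OF S f] L2_mult_integrable[OF S S]
    by simp
  finally show ?thesis using SS Sf by (simp add: c_def)
qed

section \<open>The Sturm-Liouville operator\<close>

lemma SL_interior_regularity:
  assumes p: "Ck_on 1 {0..l} p" and f: "Ck_on 2 {0<..<l} f" and x: "x \<in> {0<..<l}"
  shows "(f has_real_derivative deriv f x) (at x)"
    and "((\<lambda>y. p y * deriv f y) has_real_derivative deriv (\<lambda>y. p y * deriv f y) x) (at x)"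
proof -
  obtain g g2 where g: "\<And>x. x \<in> {0<..<l} \<Longrightarrow> (f has_real_derivative g x) (at x within {0<..<l})"
      "\<And>x. x \<in> {0<..<l} \<Longrightarrow> (g has_real_derivative g2 x) (at x within {0<..<l})"
    using f by (auto simp: numeral_2_eq_2 Ball_def)
  have o: "at x within {0<..<l} = at x" if "x \<in> {0<..<l}" for x
    using that by (intro at_within_open) auto
  have d: "deriv f x = g x" if "x \<in> {0<..<l}" for x
    using g(1)[OF that] o[OF that] by (auto dest: DERIV_imp_deriv)
  show "(f has_real_derivative deriv f x) (at x)" using g(1)[OF x] o[OF x] d[OF x] by simp
  obtain p1 where p1: "\<And>x. x \<in> {0..l} \<Longrightarrow> (p has_real_derivative p1 x) (at x within {0..l})"
    using p by (auto simp: Ball_def)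
  have "at x within {0..l} = at x" using x by (intro at_within_interior) simp
  then have "(p has_real_derivative p1 x) (at x)" using p1[of x] x by auto
  moreover have "(g has_real_derivative g2 x) (at x)" using g(2)[OF x] o[OF x] by auto
  ultimately have *: "((\<lambda>y. p y * g y) has_real_derivative (p x * g2 x + p1 x * g x)) (at x)"
    by (rule DERIV_mult')
  have "((\<lambda>y. p y * deriv f y) has_real_derivative (p x * g2 x + p1 x * g x)) (at x)"
    using has_field_derivative_transform_within_open[OF *, of "{0<..<l}"] x d by auto
  then show "((\<lambda>y. p y * deriv f y) has_real_derivative deriv (\<lambda>y. p y * deriv f y) x) (at x)"
    using DERIV_imp_deriv by fastforce
qed

text \<open>The flux \<open>p f'\<close> is the natural unknown of the equation; dividing by the \<open>C\<^sup>1\<close> function \<open>p\<close>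
  recovers a second derivative of \<open>f\<close>.\<close>

lemma Ck_on_2_of_flux:
  assumes p: "Ck_on 1 {0..l} p" and p0: "\<And>x. x \<in> {0..l} \<Longrightarrow> 0 < p x"
    and f: "\<And>x. x \<in> {0<..<l} \<Longrightarrow> (f has_real_derivative f1 x) (at x)"
    and F: "\<And>x. x \<in> {0<..<l} \<Longrightarrow> ((\<lambda>y. p y * f1 y) has_real_derivative F x) (at x)"
    and Fc: "continuous_on {0<..<l} F"
  shows "Ck_on 2 {0<..<l} f"
    and "x \<in> {0<..<l} \<Longrightarrow> deriv (\<lambda>y. p y * deriv f y) x = F x"
proof -
  let ?S = "{0<..<l}"
  obtain p1 where p1: "\<And>x. x \<in> {0..l} \<Longrightarrow> (p has_real_derivative p1 x) (at x within {0..l})" "continuous_on {0..l} p1"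
    using p by (auto simp: Ball_def)
  have dp: "(p has_real_derivative p1 x) (at x)" if x: "x \<in> ?S" for x
  proof -
    have "at x within {0..l} = at x" using x by (intro at_within_interior) simp
    then show ?thesis using p1(1)[of x] x by auto
  qed
  have pn: "p x \<noteq> 0" if "x \<in> ?S" for x using p0[of x] that by auto
  define f2 where "f2 x = (F x * p x - p x * f1 x * p1 x) / (p x * p x)" for x
  have df1: "(f1 has_real_derivative f2 x) (at x)" if x: "x \<in> ?S" for x
  proof -
    have "((\<lambda>y. (p y * f1 y) / p y) has_real_derivative f2 x) (at x)"
      unfolding f2_def using F[OF x] dp[OF x] pn[OF x] by (rule DERIV_divide)
    then show ?thesis
      by (rule has_field_derivative_transform_within_open[of _ _ _ ?S]) (use x pn in auto)
  qed
  have cont: "continuous_on ?S p" "continuous_on ?S f1" "continuous_on ?S p1"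
    by (rule DERIV_continuous_on[OF dp[THEN has_field_derivative_at_within]], assumption,
        rule DERIV_continuous_on[OF df1[THEN has_field_derivative_at_within]], assumption,
        rule continuous_on_subset[OF p1(2)], auto)
  have "continuous_on ?S f2" unfolding f2_def using pn by (intro continuous_intros cont Fc) auto
  then show "Ck_on 2 ?S f"
    unfolding numeral_2_eq_2 Ck_on.simps
    by (intro exI[of _ f1] exI[of _ f2] conjI ballI f[THEN has_field_derivative_at_within]
        df1[THEN has_field_derivative_at_within])
  assume x: "x \<in> ?S"
  have "((\<lambda>y. p y * deriv f y) has_real_derivative F x) (at x)"
    by (rule has_field_derivative_transform_within_open[OF F[OF x], of ?S])
      (use x DERIV_imp_deriv[OF f] in auto)
  then show "deriv (\<lambda>y. p y * deriv f y) x = F x" by (rule DERIV_imp_deriv)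
qed

text \<open>The flux vanishes at the maximum. If its derivative were positive there, the flux, and with it
  \<open>f'\<close>, would be positive just to the right, where \<open>f\<close> would exceed its maximum.\<close>

lemma flux_derivative_nonpos_at_max:
  fixes f f1 :: "real \<Rightarrow> real"
  assumes x: "x \<in> {0<..<l}" and p: "\<And>y. y \<in> {0<..<l} \<Longrightarrow> 0 < p y"
    and f: "\<And>y. y \<in> {0<..<l} \<Longrightarrow> (f has_real_derivative f1 y) (at y)"
    and R: "((\<lambda>y. p y * f1 y) has_real_derivative R) (at x)"
    and max: "\<And>y. y \<in> {0<..<l} \<Longrightarrow> f y \<le> f x"
  shows "R \<le> 0"
proof (rule ccontr)
  assume "\<not> R \<le> 0"
  define d0 where "d0 = min x (l - x)"
  have d0: "d0 > 0" using x by (auto simp: d0_def)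
  have "f1 x = 0"
    using max by (intro DERIV_local_max[OF f[OF x] d0]) (auto simp: d0_def abs_if split: if_splits)
  obtain d where d: "d > 0" "\<And>h. 0 < h \<Longrightarrow> h < d \<Longrightarrow> p x * f1 x < p (x + h) * f1 (x + h)"
    using DERIV_pos_inc_right[OF R] \<open>\<not> R \<le> 0\<close> by auto
  define y where "y = x + min (d / 2) (d0 / 2)"
  have y: "x < y" "y \<in> {0<..<l}" "y - x < d" using d d0 x by (auto simp: y_def d0_def min_def field_simps)
  have pos: "0 < f1 z" if "x < z" "z < y" for z
  proof -
    have "0 < p z * f1 z" using d(2)[of "z - x"] that y \<open>f1 x = 0\<close> by auto
    then show ?thesis using p[of z] that y x by (simp add: zero_less_mult_iff)
  qed
  obtain z where "x < z" "z < y" "f y - f x = (y - x) * f1 z"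
    using MVT2[of x y f f1] y x f by auto
  then have "f x < f y" using pos[of z] y(1) by (smt (verit) mult_pos_pos)
  then show False using max[OF y(2)] by simp
qed

text \<open>The Dirichlet problem \<open>L f = g\<close> with the derivative \<open>f1\<close> of \<open>f\<close> as a parameter, stated through
  the flux \<open>p f1\<close>. As a relation, unlike the operator given by \<open>deriv\<close>, it is visibly linear, and it
  does not mention second derivatives.\<close>

definition SL_bvp where
  "SL_bvp l p q f f1 g \<longleftrightarrow>
     continuous_on {0..l} f1 \<and>
     (\<forall>x\<in>{0..l}. (f has_real_derivative f1 x) (at x within {0..l})) \<and>
     (\<forall>x\<in>{0<..<l}. ((\<lambda>y. p y * f1 y) has_real_derivative q x * f x - g x) (at x)) \<and>
     f 0 = 0 \<and> f l = 0 \<and> g \<in> L2 l" for l :: real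

lemma SL_bvp_continuous: "SL_bvp l p q f f1 g \<Longrightarrow> continuous_on {0..l} f"
  by (auto simp: SL_bvp_def intro!: DERIV_continuous_on)

lemma SL_bvp_L2: "SL_bvp l p q f f1 g \<Longrightarrow> f \<in> L2 l"
  by (intro L2_continuous SL_bvp_continuous)

lemma SL_bvp_cong: "SL_bvp l p q f f1 g \<Longrightarrow> (\<And>x. x \<in> {0<..<l} \<Longrightarrow> g x = g' x) \<Longrightarrow> SL_bvp l p q f f1 g'"
  using L2_cong[of g l g'] by (auto simp: SL_bvp_def)

lemma SL_bvp_lincomb:
  assumes "\<And>i. i \<in> I \<Longrightarrow> SL_bvp l p q (f i) (f1 i) (g i)"
  shows "SL_bvp l p q (\<lambda>x. \<Sum>i\<in>I. a i * f i x) (\<lambda>x. \<Sum>i\<in>I. a i * f1 i x) (\<lambda>x. \<Sum>i\<in>I. a i * g i x)"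
  unfolding SL_bvp_def
proof (intro conjI ballI)
  show "continuous_on {0..l} (\<lambda>x. \<Sum>i\<in>I. a i * f1 i x)"
    using assms by (auto intro!: continuous_intros simp: SL_bvp_def)
  show "((\<lambda>x. \<Sum>i\<in>I. a i * f i x) has_real_derivative (\<Sum>i\<in>I. a i * f1 i x)) (at x within {0..l})" if "x \<in> {0..l}" for x
    using assms that by (intro DERIV_sum DERIV_cmult) (auto simp: SL_bvp_def)
  show "((\<lambda>y. p y * (\<Sum>i\<in>I. a i * f1 i y)) has_real_derivative
         q x * (\<Sum>i\<in>I. a i * f i x) - (\<Sum>i\<in>I. a i * g i x)) (at x)" if "x \<in> {0<..<l}" for x
  proof -
    have "((\<lambda>y. \<Sum>i\<in>I. a i * (p y * f1 i y)) has_real_derivative (\<Sum>i\<in>I. a i * (q x * f i x - g i x))) (at x)"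
      using assms that by (intro DERIV_sum DERIV_cmult) (auto simp: SL_bvp_def)
    then show ?thesis by (simp add: sum_distrib_left sum_subtractf algebra_simps)
  qed
qed (use assms in \<open>auto simp: SL_bvp_def intro!: L2_sum L2_cmult\<close>)

lemma SL_space_imp_bvp:
  assumes p: "Ck_on 1 {0..l} p" and f: "f \<in> SL_space l p q"
  shows "\<exists>f1. SL_bvp l p q f f1 (SL_op p q f)"
proof -
  obtain f1 where f1: "continuous_on {0..l} f1"
      "\<And>x. x \<in> {0..l} \<Longrightarrow> (f has_real_derivative f1 x) (at x within {0..l})"
    using f by (auto simp: SL_space_def)
  have d1: "deriv f x = f1 x" if "x \<in> {0<..<l}" for x
  proof -
    have "at x within {0..l} = at x" using that by (intro at_within_interior) simp
    then show ?thesis using f1(2)[of x] that by (auto intro: DERIV_imp_deriv)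
  qed
  have f2: "Ck_on 2 {0<..<l} f" using f by (simp add: SL_space_def)
  have "((\<lambda>y. p y * f1 y) has_real_derivative q x * f x - SL_op p q f x) (at x)" if x: "x \<in> {0<..<l}" for x
  proof -
    have "((\<lambda>y. p y * f1 y) has_real_derivative deriv (\<lambda>y. p y * deriv f y) x) (at x)"
      by (rule has_field_derivative_transform_within_open[OF SL_interior_regularity(2)[OF p f2 x], of "{0<..<l}"])
        (use x d1 in auto)
    then show ?thesis by (simp add: SL_op_def)
  qed
  then show ?thesis using f1 f by (auto simp: SL_bvp_def SL_space_def)
qed

text \<open>The function \<open>p f' h\<close> vanishes at both endpoints; integrate its derivative.\<close>

lemma SL_green:
  assumes l: "0 \<le> l" and p: "continuous_on {0..l} p" and q: "continuous_on {0..l} q"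
    and f: "SL_bvp l p q f f1 g" and h: "SL_bvp l p q h h1 g'"
  shows "L2_inner l g h = (\<integral>x. p x * f1 x * h1 x + q x * f x * h x \<partial>lebesgue_on {0<..<l})"
proof -
  let ?M = "lebesgue_on {0<..<l}"
  have cf: "continuous_on {0..l} f" "continuous_on {0..l} h" "continuous_on {0..l} f1" "continuous_on {0..l} h1"
    using f h SL_bvp_continuous by (auto simp: SL_bvp_def)
  have gL: "g \<in> L2 l" using f by (simp add: SL_bvp_def)
  have i1: "integrable ?M (\<lambda>x. g x * h x)" by (intro L2_mult_integrable gL SL_bvp_L2[OF h])
  have i2: "integrable ?M (\<lambda>x. p x * f1 x * h1 x + q x * f x * h x)"
    by (intro integrable_lebesgue_on_Ioo_continuous continuous_intros p q cf)
  have "((\<lambda>x. p x * f1 x * h1 x + q x * f x * h x - g x * h x) has_integral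
     (p l * f1 l * h l - p 0 * f1 0 * h 0)) {0..l}"
  proof (rule fundamental_theorem_of_calculus_interior)
    show "continuous_on {0..l} (\<lambda>x. p x * f1 x * h x)" by (intro continuous_intros p cf)
    fix x assume x: "x \<in> {0<..<l}"
    have "at x within {0..l} = at x" using x by (intro at_within_interior) simp
    moreover have "(h has_real_derivative h1 x) (at x within {0..l})"
      using h x by (simp add: SL_bvp_def)
    ultimately have "(h has_real_derivative h1 x) (at x)" by simp
    moreover have "((\<lambda>y. p y * f1 y) has_real_derivative q x * f x - g x) (at x)"
      using f x by (simp add: SL_bvp_def)
    ultimately have "((\<lambda>x. p x * f1 x * h x) has_real_derivative (p x * f1 x * h1 x + (q x * f x - g x) * h x)) (at x)"
      by (intro DERIV_mult')
    then show "((\<lambda>x. p x * f1 x * h x) has_vector_derivative p x * f1 x * h1 x + q x * f x * h x - g x * h x) (at x)"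
      by (simp add: has_real_derivative_iff_has_vector_derivative algebra_simps)
  qed (use l in auto)
  moreover have "((\<lambda>x. p x * f1 x * h1 x + q x * f x * h x - g x * h x) has_integral
      (\<integral>x. p x * f1 x * h1 x + q x * f x * h x - g x * h x \<partial>?M)) {0..l}"
    by (intro has_integral_Icc_lebesgue_on_Ioo Bochner_Integration.integrable_diff i1 i2)
  ultimately have "(\<integral>x. p x * f1 x * h1 x + q x * f x * h x - g x * h x \<partial>?M) = p l * f1 l * h l - p 0 * f1 0 * h 0"
    by (rule has_integral_unique[rotated])
  also have "\<dots> = 0" using h by (simp add: SL_bvp_def)
  finally have "(\<integral>x. p x * f1 x * h1 x + q x * f x * h x - g x * h x \<partial>?M) = 0" .
  then show ?thesis unfolding L2_inner_def using i1 i2 by (simp add: Bochner_Integration.integral_diff)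
qed

lemma SL_symmetric:
  assumes l: "0 \<le> l" and p: "continuous_on {0..l} p" and q: "continuous_on {0..l} q"
    and f: "SL_bvp l p q f f1 g" and h: "SL_bvp l p q h h1 g'"
  shows "L2_inner l g h = L2_inner l f g'"
  using SL_green[OF assms] SL_green[OF l p q h f] by (simp add: L2_inner_commute[of l f] mult_ac)

text \<open>Integrating \<open>(h' - m)\<^sup>2 \<ge> 0\<close> over \<open>[0, x]\<close> with the mean slope \<open>m = h x / x\<close> gives the
  Cauchy-Schwarz inequality \<open>(h x)\<^sup>2 \<le> x \<integral> (h')\<^sup>2\<close> without square roots.\<close>

lemma Cauchy_Schwarz_interval:
  fixes h h1 :: "real \<Rightarrow> real"
  assumes "\<And>x. x \<in> {0..l} \<Longrightarrow> (h has_real_derivative h1 x) (at x within {0..l})"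
    and h1: "continuous_on {0..l} h1" and "h 0 = 0" and x: "x \<in> {0..l}"
  shows "(h x)\<^sup>2 \<le> l * (\<integral>x. (h1 x)\<^sup>2 \<partial>lebesgue_on {0<..<l})"
proof (cases "x = 0")
  case True
  then show ?thesis using x \<open>h 0 = 0\<close> by simp
next
  case False
  then have xp: "0 < x" "x \<le> l" using x by auto
  define m where "m = h x / x"
  have "(h has_vector_derivative h1 s) (at s within {0..x})" if "s \<in> {0..x}" for s
    using DERIV_subset[OF assms(1)[of s], of "{0..x}"] that xp
    by (auto simp: has_real_derivative_iff_has_vector_derivative)
  then have "(h1 has_integral h x - h 0) {0..x}"
    using xp by (intro fundamental_theorem_of_calculus) auto
  then have 1: "(h1 has_integral h x) {0..x}" using assms by simp
  have c: "continuous_on {0..x} h1" using h1 xp by (auto intro: continuous_on_subset)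
  obtain J where J: "((\<lambda>s. (h1 s)\<^sup>2) has_integral J) {0..x}"
    using integrable_continuous_interval[of 0 x "\<lambda>s. (h1 s)\<^sup>2"] c by (auto intro!: continuous_intros simp: integrable_on_def)
  have "((\<lambda>s. (h1 s)\<^sup>2 - 2 * m * h1 s + m\<^sup>2) has_integral (J - 2 * m * h x + x * m\<^sup>2)) {0..x}"
    using has_integral_add[OF has_integral_diff[OF J has_integral_mult_right[OF 1, of "2 * m"]] has_integral_const_real[of "m\<^sup>2" 0 x]] xp
    by simp
  then have "0 \<le> J - 2 * m * h x + x * m\<^sup>2"
  proof (rule has_integral_nonneg)
    fix s
    have "(h1 s)\<^sup>2 - 2 * m * h1 s + m\<^sup>2 = (h1 s - m)\<^sup>2" by (simp add: power2_diff mult_ac)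
    then show "0 \<le> (h1 s)\<^sup>2 - 2 * m * h1 s + m\<^sup>2" by simp
  qed
  also have "J - 2 * m * h x + x * m\<^sup>2 = J - (h x)\<^sup>2 / x"
    using xp by (simp add: m_def power2_eq_square field_simps)
  finally have a: "(h x)\<^sup>2 \<le> x * J" using xp by (simp add: field_simps)
  have K: "((\<lambda>s. (h1 s)\<^sup>2) has_integral (\<integral>x. (h1 x)\<^sup>2 \<partial>lebesgue_on {0<..<l})) {0..l}"
    using h1 by (intro has_integral_Icc_lebesgue_on_Ioo integrable_lebesgue_on_Ioo_continuous continuous_intros)
  have "J \<le> (\<integral>x. (h1 x)\<^sup>2 \<partial>lebesgue_on {0<..<l})"
    using xp by (intro has_integral_subset_le[OF _ J K]) auto
  moreover have "0 \<le> (\<integral>x. (h1 x)\<^sup>2 \<partial>lebesgue_on {0<..<l})" by simp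
  ultimately have "x * J \<le> l * (\<integral>x. (h1 x)\<^sup>2 \<partial>lebesgue_on {0<..<l})"
    using xp by (intro mult_mono) (use J has_integral_nonneg[OF J] in auto)
  with a show ?thesis by linarith
qed

text \<open>The energy \<open>(L f, f)\<close> dominates \<open>\<integral> p (f')\<^sup>2\<close>, and hence the supremum of \<open>f\<close>, because \<open>p\<close> is bounded
  away from \<open>0\<close> and \<open>q\<close> is nonnegative.\<close>

lemma SL_sup_bound:
  assumes p: "continuous_on {0..l} p" and q: "continuous_on {0..l} q"
    and p0: "0 < p0" "\<And>x. x \<in> {0..l} \<Longrightarrow> p0 \<le> p x" and q0: "\<And>x. x \<in> {0..l} \<Longrightarrow> 0 \<le> q x"
    and f: "SL_bvp l p q f f1 g" and x: "x \<in> {0..l}"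
  shows "(f x)\<^sup>2 \<le> l / p0 * L2_inner l g f"
proof -
  let ?M = "lebesgue_on {0<..<l}"
  have l: "0 \<le> l" using x by auto
  have f1: "continuous_on {0..l} f1" using f by (simp add: SL_bvp_def)
  have "p0 * (\<integral>x. (f1 x)\<^sup>2 \<partial>?M) = (\<integral>x. p0 * (f1 x)\<^sup>2 \<partial>?M)" by simp
  also have "\<dots> \<le> (\<integral>x. p x * f1 x * f1 x + q x * f x * f x \<partial>?M)"
  proof (rule integral_mono)
    show "integrable ?M (\<lambda>x. p0 * (f1 x)\<^sup>2)"
      by (intro integrable_lebesgue_on_Ioo_continuous continuous_intros f1)
    show "integrable ?M (\<lambda>x. p x * f1 x * f1 x + q x * f x * f x)"
      by (intro integrable_lebesgue_on_Ioo_continuous continuous_intros f1 p q SL_bvp_continuous[OF f])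
    fix x assume "x \<in> space ?M"
    then have x: "x \<in> {0..l}" by auto
    have "p0 * (f1 x)\<^sup>2 \<le> p x * (f1 x)\<^sup>2" using p0(2)[OF x] by (intro mult_right_mono) auto
    moreover have "0 \<le> q x * (f x)\<^sup>2" using q0[OF x] by simp
    ultimately show "p0 * (f1 x)\<^sup>2 \<le> p x * f1 x * f1 x + q x * f x * f x"
      by (simp add: power2_eq_square mult_ac)
  qed
  also have "\<dots> = L2_inner l g f" using SL_green[OF l p q f f] by simp
  finally have "(\<integral>x. (f1 x)\<^sup>2 \<partial>?M) \<le> L2_inner l g f / p0" using p0(1) by (simp add: field_simps)
  then have "l * (\<integral>x. (f1 x)\<^sup>2 \<partial>?M) \<le> l * (L2_inner l g f / p0)" using l by (rule mult_left_mono)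
  moreover have "(f x)\<^sup>2 \<le> l * (\<integral>x. (f1 x)\<^sup>2 \<partial>?M)"
    using f by (intro Cauchy_Schwarz_interval[OF _ f1 _ x]) (auto simp: SL_bvp_def)
  ultimately show ?thesis by simp
qed

section \<open>Uniform convergence of series\<close>

lemma uniformly_Cauchy_on_seriesI:
  fixes f :: "nat \<Rightarrow> 'a \<Rightarrow> 'b::real_normed_vector"
  assumes "\<And>e. e > 0 \<Longrightarrow> \<exists>M. \<forall>x\<in>A. \<forall>m\<ge>M. \<forall>n>m. norm (\<Sum>i\<in>{m..<n}. f i x) < e"
  shows "uniformly_Cauchy_on A (\<lambda>n x. \<Sum>i<n. f i x)"
proof (rule uniformly_Cauchy_onI')
  fix e :: real assume "e > 0"
  then obtain M where M: "\<And>x m n. x \<in> A \<Longrightarrow> m \<ge> M \<Longrightarrow> n > m \<Longrightarrow> norm (\<Sum>i\<in>{m..<n}. f i x) < e"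
    using assms by blast
  have "dist (\<Sum>i<m. f i x) (\<Sum>i<n. f i x) < e" if "x \<in> A" "m \<ge> M" "n > m" for x m n
  proof -
    have "(\<Sum>i<n. f i x) - (\<Sum>i<m. f i x) = (\<Sum>i\<in>{m..<n}. f i x)"
      using that sum_diff_nat_ivl[of 0 m n "\<lambda>i. f i x"] by (simp add: atLeast0LessThan)
    then show ?thesis using M[OF that] by (subst dist_commute) (simp add: dist_norm)
  qed
  then show "\<exists>M. \<forall>x\<in>A. \<forall>m\<ge>M. \<forall>n>m. dist (\<Sum>i<m. f i x) (\<Sum>i<n. f i x) < e" by blast
qed

lemma uniformly_Cauchy_on_seriesD:
  fixes f :: "nat \<Rightarrow> 'a \<Rightarrow> 'b::real_normed_vector"
  assumes "uniformly_Cauchy_on A (\<lambda>n x. \<Sum>i<n. f i x)" "e > 0"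
  obtains M where "\<And>x m n. x \<in> A \<Longrightarrow> M \<le> m \<Longrightarrow> m \<le> n \<Longrightarrow> norm (\<Sum>i\<in>{m..<n}. f i x) < e"
proof -
  obtain M where M: "\<And>x m n. x \<in> A \<Longrightarrow> m \<ge> M \<Longrightarrow> n \<ge> M \<Longrightarrow> dist (\<Sum>i<m. f i x) (\<Sum>i<n. f i x) < e"
    using assms unfolding uniformly_Cauchy_on_def by blast
  show thesis
  proof (rule that[of M])
    fix x m n assume "x \<in> A" "M \<le> m" "m \<le> n"
    moreover from this have "(\<Sum>i<n. f i x) - (\<Sum>i<m. f i x) = (\<Sum>i\<in>{m..<n}. f i x)"
      using sum_diff_nat_ivl[of 0 m n "\<lambda>i. f i x"] by (simp add: atLeast0LessThan)
    ultimately show "norm (\<Sum>i\<in>{m..<n}. f i x) < e"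
      using M[of x n m] by (simp add: dist_norm)
  qed
qed

text \<open>The map \<open>\<phi>\<close> allows the majorant to depend on part of the variables only: a series in \<open>(x, t)\<close> is
  compared with one in \<open>x\<close>.\<close>

lemma uniformly_Cauchy_on_series_dominated:
  fixes a :: "nat \<Rightarrow> 'a \<Rightarrow> real" and b :: "nat \<Rightarrow> 'b \<Rightarrow> 'c::real_normed_vector"
  assumes "uniformly_Cauchy_on A (\<lambda>n x. \<Sum>i<n. a i x)"
    and "\<And>y. y \<in> B \<Longrightarrow> \<phi> y \<in> A" "\<And>i y. y \<in> B \<Longrightarrow> norm (b i y) \<le> K * a i (\<phi> y)" "0 \<le> K"
  shows "uniformly_Cauchy_on B (\<lambda>n y. \<Sum>i<n. b i y)"
proof (rule uniformly_Cauchy_on_seriesI)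
  fix e :: real assume "e > 0"
  then have "e / (K + 1) > 0" using assms(4) by auto
  then obtain M where M: "\<And>x m n. x \<in> A \<Longrightarrow> M \<le> m \<Longrightarrow> m \<le> n \<Longrightarrow> norm (\<Sum>i\<in>{m..<n}. a i x) < e / (K + 1)"
    using uniformly_Cauchy_on_seriesD[OF assms(1)] by blast
  have "norm (\<Sum>i\<in>{m..<n}. b i y) < e" if "y \<in> B" "m \<ge> M" "n > m" for y m n
  proof -
    have "norm (\<Sum>i\<in>{m..<n}. b i y) \<le> (\<Sum>i\<in>{m..<n}. K * a i (\<phi> y))"
      using assms(3)[OF that(1)] by (rule sum_norm_le)
    also have "\<dots> \<le> K * norm (\<Sum>i\<in>{m..<n}. a i (\<phi> y))"
      unfolding sum_distrib_left [symmetric] using assms(4) by (intro mult_left_mono) auto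
    also have "\<dots> \<le> (K + 1) * norm (\<Sum>i\<in>{m..<n}. a i (\<phi> y))" by (intro mult_right_mono) auto
    also have "\<dots> < (K + 1) * (e / (K + 1))"
      using M[of "\<phi> y" m n] that assms by (intro mult_strict_left_mono) auto
    also have "\<dots> = e" using assms(4) by simp
    finally show ?thesis .
  qed
  then show "\<exists>M. \<forall>x\<in>B. \<forall>m\<ge>M. \<forall>n>m. norm (\<Sum>i\<in>{m..<n}. b i x) < e" by blast
qed

lemma uniformly_Cauchy_on_imp_uniform_limit_suminf:
  fixes f :: "nat \<Rightarrow> 'a \<Rightarrow> 'b::banach"
  assumes "uniformly_Cauchy_on A (\<lambda>n x. \<Sum>i<n. f i x)"
  shows "uniform_limit A (\<lambda>n x. \<Sum>i<n. f i x) (\<lambda>x. \<Sum>i. f i x) sequentially"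
    and "\<And>x. x \<in> A \<Longrightarrow> summable (\<lambda>i. f i x)"
proof -
  obtain g where g: "uniform_limit A (\<lambda>n x. \<Sum>i<n. f i x) g sequentially"
    using Cauchy_uniformly_convergent[OF assms] by (auto simp: uniformly_convergent_on_def)
  have s: "(\<lambda>i. f i x) sums g x" if "x \<in> A" for x
    using tendsto_uniform_limitI[OF g that] by (simp add: sums_def)
  then show "\<And>x. x \<in> A \<Longrightarrow> summable (\<lambda>i. f i x)" by (auto simp: sums_iff)
  have "uniform_limit A (\<lambda>n x. \<Sum>i<n. f i x) (\<lambda>x. \<Sum>i. f i x) sequentially \<longleftrightarrow>
      uniform_limit A (\<lambda>n x. \<Sum>i<n. f i x) g sequentially"
    using s by (intro uniform_limit_cong') (auto simp: sums_iff)
  then show "uniform_limit A (\<lambda>n x. \<Sum>i<n. f i x) (\<lambda>x. \<Sum>i. f i x) sequentially" using g by simp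
qed

section \<open>Eigenfunction expansions\<close>

locale SL_system =
  fixes l :: real and p q :: "real \<Rightarrow> real" and ev :: "nat \<Rightarrow> real" and X :: "nat \<Rightarrow> real \<Rightarrow> real"
  assumes l_pos: "0 < l" and p_C1: "Ck_on 1 {0..l} p" and q_cont: "continuous_on {0..l} q"
    and p_pos: "\<And>x. x \<in> {0..l} \<Longrightarrow> 0 < p x" and q_nonneg: "\<And>x. x \<in> {0..l} \<Longrightarrow> 0 \<le> q x"
    and eigensystem: "SL_eigensystem l p q ev X"
begin

lemma p_cont: "continuous_on {0..l} p"
  using p_C1 by (auto intro: DERIV_continuous_on)

lemma p_lower_bound: "\<exists>p0>0. \<forall>x\<in>{0..l}. p0 \<le> p x"
proof -
  obtain x0 where "x0 \<in> {0..l}" "\<And>x. x \<in> {0..l} \<Longrightarrow> p x0 \<le> p x"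
    using continuous_attains_inf[OF compact_Icc _ p_cont] l_pos by auto
  then show ?thesis using p_pos by blast
qed

lemma ev_pos: "0 < ev i"
  and orthonormal: "orthonormal_L2 l X"
  and complete: "complete_L2 l X"
  and eigenfunction: "SL_eigenfunction l p q (ev i) (X i)"
  using eigensystem by (auto simp: SL_eigensystem_def)

lemma X_L2: "X i \<in> L2 l" using orthonormal by (simp add: orthonormal_L2_def)

text \<open>A choice of derivative for each eigenfunction, one-sided at the endpoints.\<close>

definition "X' i = (SOME f1. SL_bvp l p q (X i) f1 (\<lambda>x. ev i * X i x))"

lemma X_bvp: "SL_bvp l p q (X i) (X' i) (\<lambda>x. ev i * X i x)"
proof -
  have "\<exists>f1. SL_bvp l p q (X i) f1 (SL_op p q (X i))"
    using eigenfunction[of i] p_C1 by (intro SL_space_imp_bvp) (auto simp: SL_eigenfunction_def)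
  then obtain f1 where f1: "SL_bvp l p q (X i) f1 (SL_op p q (X i))" ..
  have "SL_bvp l p q (X i) f1 (\<lambda>x. ev i * X i x)"
    using eigenfunction[of i] by (intro SL_bvp_cong[OF f1]) (auto simp: SL_eigenfunction_def)
  then show ?thesis unfolding X'_def by (rule someI[of "\<lambda>f1. SL_bvp l p q (X i) f1 (\<lambda>x. ev i * X i x)"])
qed

lemma X_cont: "continuous_on {0..l} (X i)" using X_bvp by (rule SL_bvp_continuous)

text \<open>For fixed \<open>x\<close>, apply the supremum bound to the sum of \<open>(X i x / ev i) X i\<close>. Its value at \<open>x\<close> and its
  energy are the same number \<open>s\<close>, namely the sum to be estimated, so the bound reads
  \<open>s\<^sup>2 \<le> C s\<close>.\<close>

lemma eigenfunction_pointwise_bound: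
  "\<exists>C. \<forall>x\<in>{0..l}. \<forall>I. finite I \<longrightarrow> (\<Sum>i\<in>I. (X i x)\<^sup>2 / ev i) \<le> C"
proof -
  obtain p0 where p0: "p0 > 0" "\<And>x. x \<in> {0..l} \<Longrightarrow> p0 \<le> p x" using p_lower_bound by blast
  have "(\<Sum>i\<in>I. (X i x)\<^sup>2 / ev i) \<le> l / p0" if x: "x \<in> {0..l}" and I: "finite I" for x I
  proof -
    define a where "a i = X i x / ev i" for i
    define s where "s = (\<Sum>i\<in>I. (X i x)\<^sup>2 / ev i)"
    have "SL_bvp l p q (\<lambda>y. \<Sum>i\<in>I. a i * X i y) (\<lambda>y. \<Sum>i\<in>I. a i * X' i y) (\<lambda>y. \<Sum>i\<in>I. a i * (ev i * X i y))"
      by (intro SL_bvp_lincomb X_bvp)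
    from SL_sup_bound[OF p_cont q_cont p0 q_nonneg this x]
    have "(\<Sum>i\<in>I. a i * X i x)\<^sup>2 \<le> l / p0 * L2_inner l (\<lambda>y. \<Sum>i\<in>I. a i * (ev i * X i y)) (\<lambda>y. \<Sum>i\<in>I. a i * X i y)"
      by simp
    also have "L2_inner l (\<lambda>y. \<Sum>i\<in>I. a i * (ev i * X i y)) (\<lambda>y. \<Sum>i\<in>I. a i * X i y) = (\<Sum>i\<in>I. (a i * ev i) * a i)"
      unfolding mult.assoc[symmetric] by (rule L2_inner_lincomb_orthonormal[OF orthonormal I])
    also have "\<dots> = s" unfolding s_def a_def using ev_pos
      by (intro sum.cong) (auto simp: power2_eq_square less_imp_neq[OF ev_pos, symmetric])
    also have "(\<Sum>i\<in>I. a i * X i x) = s" unfolding s_def a_def by (simp add: power2_eq_square)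
    finally have "s\<^sup>2 \<le> l / p0 * s" .
    moreover have "s \<ge> 0" unfolding s_def using less_imp_le[OF ev_pos] by (intro sum_nonneg) auto
    ultimately have "s \<le> l / p0"
      using l_pos p0(1) mult_right_le_imp_le[of s s "l / p0"] by (cases "s = 0") (auto simp: power2_eq_square)
    then show ?thesis by (simp add: s_def)
  qed
  then show ?thesis by blast
qed

text \<open>Symmetry of \<open>L\<close>, applied to \<open>f\<close> and an eigenfunction.\<close>

lemma fourier_coefficient:
  assumes "SL_bvp l p q f f1 g"
  shows "L2_inner l g (X i) = ev i * L2_inner l f (X i)"
proof -
  have "L2_inner l g (X i) = L2_inner l f (\<lambda>x. ev i * X i x)"
    using l_pos by (intro SL_symmetric[OF _ p_cont q_cont assms X_bvp]) auto
  then show ?thesis by (simp add: L2_inner_cmult_left L2_inner_commute[of l f])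
qed

text \<open>Write \<open>c i X i(x)\<close> as the product of \<open>sqrt (ev i) c i\<close> and \<open>X i(x) / sqrt (ev i)\<close>. The second
  factor is square-summable uniformly in \<open>x\<close>; for the first, \<open>ev i c i\<^sup>2\<close> is the product of the
  coefficients of \<open>L f\<close> and \<open>f\<close>, which are square-summable by Bessel's inequality.\<close>

lemma fourier_series_uniformly_Cauchy:
  assumes f: "SL_bvp l p q f f1 g"
  shows "uniformly_Cauchy_on {0..l} (\<lambda>n x. \<Sum>i<n. \<bar>L2_inner l f (X i) * X i x\<bar>)"
proof (rule uniformly_Cauchy_on_seriesI)
  fix e :: real assume e: "e > 0"
  define c where "c i = L2_inner l f (X i)" for i
  obtain C where C: "\<And>x I. x \<in> {0..l} \<Longrightarrow> finite I \<Longrightarrow> (\<Sum>i\<in>I. (X i x)\<^sup>2 / ev i) \<le> C"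
    using eigenfunction_pointwise_bound by blast
  have gL: "g \<in> L2 l" using f by (simp add: SL_bvp_def)
  have fL: "f \<in> L2 l" using f by (rule SL_bvp_L2)
  have "summable (\<lambda>i. ev i * (c i)\<^sup>2)"
  proof (rule summable_comparison_test'[where N = 0])
    show "summable (\<lambda>i. (L2_inner l g (X i))\<^sup>2 + (c i)\<^sup>2)"
      unfolding c_def
      by (intro summable_add bounded_imp_summable[of _ "L2_inner l g g"] bounded_imp_summable[of _ "L2_inner l f f"]
        bessel_inequality[OF orthonormal gL] bessel_inequality[OF orthonormal fL]) auto
    fix i
    have "ev i * (c i)\<^sup>2 = L2_inner l g (X i) * c i"
      by (simp add: fourier_coefficient[OF f] c_def power2_eq_square)
    also have "\<dots> \<le> (L2_inner l g (X i))\<^sup>2 + (c i)\<^sup>2"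
    proof -
      have "2 * (a * b) \<le> a\<^sup>2 + b\<^sup>2" for a b :: real using sum_squares_bound[of a b] by simp
      moreover have "0 \<le> a\<^sup>2 + b\<^sup>2" for a b :: real by simp
      ultimately show ?thesis by (smt (verit))
    qed
    finally show "norm (ev i * (c i)\<^sup>2) \<le> (L2_inner l g (X i))\<^sup>2 + (c i)\<^sup>2"
      using ev_pos[of i] by simp
  qed
  moreover have "e\<^sup>2 / (\<bar>C\<bar> + 1) > 0" using e by auto
  ultimately obtain M where M: "\<And>m n. m \<ge> M \<Longrightarrow> norm (\<Sum>i\<in>{m..<n}. ev i * (c i)\<^sup>2) < e\<^sup>2 / (\<bar>C\<bar> + 1)"
    unfolding summable_Cauchy by blast
  have "norm (\<Sum>i\<in>{m..<n}. \<bar>c i * X i x\<bar>) < e" if x: "x \<in> {0..l}" and m: "m \<ge> M" for x m n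
  proof -
    let ?I = "{m..<n}"
    let ?s = "\<Sum>i\<in>?I. \<bar>c i * X i x\<bar>"
    have pos: "0 \<le> (\<Sum>i\<in>?I. ev i * (c i)\<^sup>2)" using less_imp_le[OF ev_pos] by (intro sum_nonneg) auto
    have "?s = (\<Sum>i\<in>?I. (sqrt (ev i) * \<bar>c i\<bar>) * (\<bar>X i x\<bar> / sqrt (ev i)))"
      using ev_pos by (intro sum.cong) (auto simp: abs_mult less_imp_neq[OF ev_pos, symmetric])
    then have "?s\<^sup>2 \<le> (\<Sum>i\<in>?I. (sqrt (ev i) * \<bar>c i\<bar>)\<^sup>2) * (\<Sum>i\<in>?I. (\<bar>X i x\<bar> / sqrt (ev i))\<^sup>2)"
      using Cauchy_Schwarz_ineq_sum[of "\<lambda>i. sqrt (ev i) * \<bar>c i\<bar>" "\<lambda>i. \<bar>X i x\<bar> / sqrt (ev i)" ?I] by simp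
    also have "\<dots> = (\<Sum>i\<in>?I. ev i * (c i)\<^sup>2) * (\<Sum>i\<in>?I. (X i x)\<^sup>2 / ev i)"
      using less_imp_le[OF ev_pos] by (simp add: power_mult_distrib power_divide)
    also have "\<dots> \<le> (\<Sum>i\<in>?I. ev i * (c i)\<^sup>2) * (\<bar>C\<bar> + 1)"
      using C[OF x, of ?I] pos by (intro mult_left_mono) auto
    also have "\<dots> < e\<^sup>2 / (\<bar>C\<bar> + 1) * (\<bar>C\<bar> + 1)"
      using M[OF m, of n] pos by (intro mult_strict_right_mono) auto
    also have "\<dots> = e\<^sup>2" by simp
    finally have "?s < e" using e by (meson less_imp_le power_less_imp_less_base)
    then show ?thesis by (simp add: sum_nonneg)
  qed
  then show "\<exists>M. \<forall>x\<in>{0..l}. \<forall>m\<ge>M. \<forall>n>m. norm (\<Sum>i\<in>{m..<n}. \<bar>L2_inner l f (X i) * X i x\<bar>) < e"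
    unfolding c_def by blast
qed

text \<open>The sum of the series is continuous and has the same coefficients as \<open>f\<close>. By completeness the
  two agree almost everywhere, and then everywhere by continuity.\<close>

lemma fourier_expansion:
  assumes f: "SL_bvp l p q f f1 g" and x: "x \<in> {0..l}"
  shows "(\<lambda>i. L2_inner l f (X i) * X i x) sums f x"
proof -
  define c where "c i = L2_inner l f (X i)" for i
  define S where "S n x = (\<Sum>i<n. c i * X i x)" for n x
  define s where "s x = (\<Sum>i. c i * X i x)" for x
  have fL: "f \<in> L2 l" using f by (rule SL_bvp_L2)
  have "uniformly_Cauchy_on {0..l} (\<lambda>n x. \<Sum>i<n. c i * X i x)"
    by (rule uniformly_Cauchy_on_series_dominated[OF fourier_series_uniformly_Cauchy[OF f], where \<phi> = id and K = 1])
      (auto simp: c_def)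
  from uniformly_Cauchy_on_imp_uniform_limit_suminf[OF this]
  have lim: "uniform_limit {0..l} S s sequentially" and sm: "summable (\<lambda>i. c i * X i x)"
    using x by (auto simp: S_def[abs_def] s_def[abs_def])
  have Sc: "continuous_on {0..l} (S n)" for n unfolding S_def by (intro continuous_intros X_cont)
  have sc: "continuous_on {0..l} s"
    using Sc by (intro uniform_limit_theorem[OF _ lim]) auto
  have sL: "s \<in> L2 l" using sc by (rule L2_continuous)
  have inner: "L2_inner l s (X j) = c j" for j
  proof -
    have bX: "bounded (X j ` {0..l})" using X_cont by (intro compact_imp_bounded compact_continuous_image) auto
    have bs: "bounded (s ` {0..l})" using sc by (intro compact_imp_bounded compact_continuous_image) auto
    have "uniform_limit {0..l} (\<lambda>n x. S n x * X j x) (\<lambda>x. s x * X j x) sequentially"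
      using uniform_lim_mult[OF lim uniform_limit_const bs bX] by simp
    then obtain I J where IJ: "\<And>n. ((\<lambda>x. S n x * X j x) has_integral I n) {0..l}"
       "((\<lambda>x. s x * X j x) has_integral J) {0..l}" "I \<longlonglongrightarrow> J"
      using Sc X_cont by (elim uniform_limit_integral) (auto intro!: continuous_intros)
    have "J = L2_inner l s (X j)"
      using has_integral_Icc_lebesgue_on_Ioo[OF L2_mult_integrable[OF sL X_L2]] IJ(2)
      unfolding L2_inner_def by (rule has_integral_unique[rotated])
    moreover have "I n = L2_inner l (S n) (X j)" for n
      using has_integral_Icc_lebesgue_on_Ioo[OF L2_mult_integrable[OF L2_continuous[OF Sc] X_L2]] IJ(1)
      unfolding L2_inner_def by (rule has_integral_unique[rotated])
    moreover have "L2_inner l (S n) (X j) = c j" if "n > j" for n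
    proof -
      have "L2_inner l (S n) (X j) = (\<Sum>i<n. c i * L2_inner l (X i) (X j))"
        unfolding S_def by (subst L2_inner_sum_left) (auto intro!: L2_cmult X_L2 simp: L2_inner_cmult_left)
      also have "\<dots> = (\<Sum>i<n. if i = j then c j else 0)"
        using orthonormal by (intro sum.cong) (auto simp: orthonormal_L2_def)
      finally show ?thesis using that by simp
    qed
    ultimately have "eventually (\<lambda>n. I n = c j) sequentially"
      by (auto intro: eventually_mono[OF eventually_gt_at_top[of j]])
    then have "I \<longlonglongrightarrow> c j" by (rule tendsto_eventually)
    then show ?thesis using IJ(3) \<open>J = _\<close> LIMSEQ_unique by blast
  qed
  define h where "h x = f x + (-1) * s x" for x
  have hc: "continuous_on {0..l} h"
    unfolding h_def by (intro continuous_intros SL_bvp_continuous[OF f] sc)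
  have hL: "h \<in> L2 l" using hc by (rule L2_continuous)
  have "L2_inner l h (X i) = 0" for i
    unfolding h_def using L2_inner_add_left[OF fL L2_cmult[OF sL, of "-1"] X_L2, of i]
    by (simp only: L2_inner_cmult_left inner) (simp add: c_def)
  then have "AE x in lebesgue_on {0<..<l}. h x = 0"
    using complete hL by (auto simp: complete_L2_def)
  then have "AE x in lebesgue_on {0<..<l}. h x * h x = 0" by eventually_elim simp
  then have "(\<integral>x. h x * h x \<partial>lebesgue_on {0<..<l}) = 0" by (rule integral_eq_zero_AE)
  then have "((\<lambda>x. h x * h x) has_integral 0) (cbox 0 l)"
    using has_integral_Icc_lebesgue_on_Ioo[OF L2_mult_integrable[OF hL hL]] by simp
  moreover have "continuous_on (cbox 0 l) (\<lambda>x. h x * h x)"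
    using hc by (auto intro!: continuous_intros)
  ultimately have "h x * h x = 0"
    using has_integral_0_cbox_imp_0[of 0 l "\<lambda>x. h x * h x" x] l_pos x by auto
  then have "s x = f x" by (simp add: h_def)
  then show ?thesis using sm by (simp add: s_def c_def sums_iff)
qed

text \<open>The derivatives of the flux converge uniformly by assumption. To integrate this back to convergence
  of the fluxes themselves, one needs control at one point. A difference of partial sums vanishes at both ends, so
  by Rolle its flux has a zero, and the mean value theorem bounds the flux everywhere.\<close>

lemma termwise_SL_operator:
  assumes c1: "uniformly_Cauchy_on {0..l} (\<lambda>n x. \<Sum>i<n. a i * X i x)"
    and c2: "uniformly_Cauchy_on {0..l} (\<lambda>n x. \<Sum>i<n. a i * (ev i * X i x))"
  shows "\<exists>u1. \<forall>x\<in>{0<..<l}. ((\<lambda>x. \<Sum>i. a i * X i x) has_real_derivative u1 x) (at x) \<and>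
     ((\<lambda>y. p y * u1 y) has_real_derivative
        q x * (\<Sum>i. a i * X i x) - (\<Sum>i. a i * (ev i * X i x))) (at x)"
proof -
  let ?S = "{0<..<l}"
  obtain p0 where p0: "p0 > 0" "\<And>x. x \<in> {0..l} \<Longrightarrow> p0 \<le> p x" using p_lower_bound by blast
  have "bounded (q ` {0..l})" using q_cont by (intro compact_imp_bounded compact_continuous_image) auto
  then obtain Q where "Q > 0" "\<forall>y\<in>q ` {0..l}. norm y \<le> Q" unfolding bounded_pos by blast
  then have Q: "\<And>x. x \<in> {0..l} \<Longrightarrow> \<bar>q x\<bar> \<le> Q" "Q > 0" by auto
  have half: "l / 2 \<in> ?S" using l_pos by auto
  have intS: "x \<in> interior ?S" if "x \<in> ?S" for x using that by (simp add: interior_open)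
  have atS: "(f has_real_derivative D) (at x within ?S) \<longleftrightarrow> (f has_real_derivative D) (at x)" if "x \<in> ?S" for f D x
    using that at_within_open[of x ?S] by simp
  have dX: "(X n has_real_derivative X' n x) (at x)" if "x \<in> ?S" for n x
  proof -
    have "(X n has_real_derivative X' n x) (at x within {0..l})" using X_bvp[of n] that by (auto simp: SL_bvp_def)
    moreover have "at x within {0..l} = at x" using that by (intro at_within_interior) simp
    ultimately show ?thesis by simp
  qed
  have tail: "\<bar>p x * (\<Sum>i\<in>I. a i * X' i x)\<bar> \<le> l * (Q * A + B)"
    if "x \<in> ?S" "\<And>x. x \<in> {0..l} \<Longrightarrow> \<bar>\<Sum>i\<in>I. a i * X i x\<bar> \<le> A" "\<And>x. x \<in> {0..l} \<Longrightarrow> \<bar>\<Sum>i\<in>I. a i * (ev i * X i x)\<bar> \<le> B" for x A B I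
  proof -
    let ?F = "\<lambda>x. \<Sum>i\<in>I. a i * X i x" and ?F1 = "\<lambda>x. \<Sum>i\<in>I. a i * X' i x" and ?G = "\<lambda>x. \<Sum>i\<in>I. a i * (ev i * X i x)"
    have F: "SL_bvp l p q ?F ?F1 ?G" by (intro SL_bvp_lincomb X_bvp)
    have dF: "(?F has_real_derivative ?F1 x) (at x)" if "x \<in> ?S" for x
      using dX that by (intro DERIV_sum DERIV_cmult) auto
    have "\<exists>z. 0 < z \<and> z < l \<and> (*) (?F1 z) = (\<lambda>v. 0)"
    proof (rule Rolle_deriv)
      show "?F 0 = ?F l" "continuous_on {0..l} ?F" using F SL_bvp_continuous[OF F] by (auto simp: SL_bvp_def)
      show "(?F has_derivative (*) (?F1 x)) (at x)" if "0 < x" "x < l" for x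
        using dF[of x] that by (simp add: has_field_derivative_def)
    qed (use l_pos in auto)
    then obtain z where z: "z \<in> ?S" "?F1 z = 0" by (metis greaterThanLessThan_iff mult.right_neutral)
    have "norm (p x * ?F1 x - p z * ?F1 z) \<le> (Q * A + B) * norm (x - z)"
    proof (rule field_differentiable_bound)
      show "((\<lambda>y. p y * ?F1 y) has_real_derivative q x * ?F x - ?G x) (at x within ?S)" if "x \<in> ?S" for x
        using F that atS by (auto simp: SL_bvp_def)
      show "norm (q x * ?F x - ?G x) \<le> Q * A + B" if "x \<in> ?S" for x
      proof -
        have x: "x \<in> {0..l}" using that by auto
        have "norm (q x * ?F x - ?G x) \<le> \<bar>q x * ?F x\<bar> + \<bar>?G x\<bar>" using abs_triangle_ineq4[of "q x * ?F x" "?G x"] by simp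
        moreover have "\<bar>q x * ?F x\<bar> \<le> Q * A"
          unfolding abs_mult using Q(1)[OF x] that Q(2) \<open>\<And>x. x \<in> {0..l} \<Longrightarrow> \<bar>?F x\<bar> \<le> A\<close>[OF x]
          by (intro mult_mono) auto
        ultimately show ?thesis using \<open>\<And>x. x \<in> {0..l} \<Longrightarrow> \<bar>?G x\<bar> \<le> B\<close>[OF x] by linarith
      qed
    qed (use that z in auto)
    moreover have "(Q * A + B) * norm (x - z) \<le> (Q * A + B) * l"
    proof (rule mult_left_mono)
      show "norm (x - z) \<le> l" using that(1) z(1) by auto
      have "0 \<in> {0..l}" using l_pos by auto
      then have "0 \<le> A" "0 \<le> B" using that(2)[of 0] that(3)[of 0] abs_ge_zero order_trans by blast+
      then show "0 \<le> Q * A + B" using Q(2) by simp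
    qed
    ultimately show ?thesis using z(2) by (simp add: mult.commute)
  qed
  have c3: "uniformly_Cauchy_on ?S (\<lambda>n x. \<Sum>i<n. a i * X' i x)"
  proof (rule uniformly_Cauchy_on_seriesI)
    fix e :: real assume e: "e > 0"
    \<comment> \<open>Solves \<open>l * (Q * d + d) = p0 * e / 2\<close>, the bound \<open>tail\<close> for the flux, of which \<open>p \<ge> p0\<close> is a factor.\<close>
    define d where "d = p0 * e / (l * (Q + 1) * 2)"
    have d: "d > 0" using e p0 l_pos Q by (simp add: d_def)
    obtain M1 where M1: "\<And>x m n. x \<in> {0..l} \<Longrightarrow> M1 \<le> m \<Longrightarrow> m \<le> n \<Longrightarrow> norm (\<Sum>i\<in>{m..<n}. a i * X i x) < d"
      using uniformly_Cauchy_on_seriesD[OF c1 d] by blast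
    obtain M2 where M2: "\<And>x m n. x \<in> {0..l} \<Longrightarrow> M2 \<le> m \<Longrightarrow> m \<le> n \<Longrightarrow> norm (\<Sum>i\<in>{m..<n}. a i * (ev i * X i x)) < d"
      using uniformly_Cauchy_on_seriesD[OF c2 d] by blast
    have "norm (\<Sum>i\<in>{m..<n}. a i * X' i x) < e" if x: "x \<in> ?S" and m: "m \<ge> max M1 M2" and n: "n > m" for x m n
    proof -
      have "\<bar>p x * (\<Sum>i\<in>{m..<n}. a i * X' i x)\<bar> \<le> l * (Q * d + d)"
      proof (rule tail[OF x])
        show "\<bar>\<Sum>i\<in>{m..<n}. a i * X i y\<bar> \<le> d" if "y \<in> {0..l}" for y
          using M1[of y m n] m n that by auto
        show "\<bar>\<Sum>i\<in>{m..<n}. a i * (ev i * X i y)\<bar> \<le> d" if "y \<in> {0..l}" for y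
          using M2[of y m n] m n that by auto
      qed
      also have "\<dots> = (l * (Q + 1) * 2) * d / 2" by (simp add: algebra_simps)
      also have "\<dots> = p0 * e / 2" using l_pos Q(2) by (simp add: d_def)
      finally have A: "\<bar>p x\<bar> * \<bar>\<Sum>i\<in>{m..<n}. a i * X' i x\<bar> \<le> p0 * e / 2" by (simp add: abs_mult)
      have "p0 * \<bar>\<Sum>i\<in>{m..<n}. a i * X' i x\<bar> \<le> \<bar>p x\<bar> * \<bar>\<Sum>i\<in>{m..<n}. a i * X' i x\<bar>"
        using p0(2)[of x] x by (intro mult_right_mono) auto
      then have "p0 * \<bar>\<Sum>i\<in>{m..<n}. a i * X' i x\<bar> \<le> p0 * (e / 2)" using A by simp
      then have "\<bar>\<Sum>i\<in>{m..<n}. a i * X' i x\<bar> \<le> e / 2" using p0(1) by (rule mult_left_le_imp_le)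
      then show ?thesis using e by simp
    qed
    then show "\<exists>M. \<forall>x\<in>?S. \<forall>m\<ge>M. \<forall>n>m. norm (\<Sum>i\<in>{m..<n}. a i * X' i x) < e" by blast
  qed
  have sub: "x \<in> {0..l}" if "x \<in> ?S" for x using that by auto
  note lim3 = uniformly_Cauchy_on_imp_uniform_limit_suminf[OF c3]
  note lim1 = uniformly_Cauchy_on_imp_uniform_limit_suminf[OF c1]
  note lim2 = uniformly_Cauchy_on_imp_uniform_limit_suminf[OF c2]
  define u1 where "u1 x = (\<Sum>i. a i * X' i x)" for x
  have "((\<lambda>x. \<Sum>i. a i * X i x) has_real_derivative u1 x) (at x)" if "x \<in> ?S" for x
    unfolding u1_def
  proof (rule has_field_derivative_series'(2)[of ?S])
    show "uniformly_convergent_on ?S (\<lambda>n x. \<Sum>i<n. a i * X' i x)" using c3 by (rule Cauchy_uniformly_convergent)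
    show "((\<lambda>x. a n * X n x) has_real_derivative a n * X' n x) (at x within ?S)" if "x \<in> ?S" for n x
      using DERIV_cmult[OF dX[OF that]] atS[OF that] by simp
    show "summable (\<lambda>n. a n * X n (l / 2))" using lim1(2) sub[OF half] by blast
  qed (use that half intS in auto)
  moreover have "((\<lambda>y. p y * u1 y) has_real_derivative
        q x * (\<Sum>i. a i * X i x) - (\<Sum>i. a i * (ev i * X i x))) (at x)" if x: "x \<in> ?S" for x
  proof -
    have "((\<lambda>x. \<Sum>i. p x * (a i * X' i x)) has_real_derivative (\<Sum>i. q x * (a i * X i x) - a i * (ev i * X i x))) (at x)"
    proof (rule has_field_derivative_series'(2)[of ?S])
      show "uniformly_convergent_on ?S (\<lambda>n x. \<Sum>i<n. q x * (a i * X i x) - a i * (ev i * X i x))"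
      proof (rule Cauchy_uniformly_convergent[OF uniformly_Cauchy_on_seriesI])
        fix e :: real assume e: "e > 0"
        define d where "d = e / (Q + 1)"
        have d: "d > 0" using e Q by (simp add: d_def)
        obtain M1 where M1: "\<And>x m n. x \<in> {0..l} \<Longrightarrow> M1 \<le> m \<Longrightarrow> m \<le> n \<Longrightarrow> norm (\<Sum>i\<in>{m..<n}. a i * X i x) < d"
          using uniformly_Cauchy_on_seriesD[OF c1 d] by blast
        obtain M2 where M2: "\<And>x m n. x \<in> {0..l} \<Longrightarrow> M2 \<le> m \<Longrightarrow> m \<le> n \<Longrightarrow> norm (\<Sum>i\<in>{m..<n}. a i * (ev i * X i x)) < d"
          using uniformly_Cauchy_on_seriesD[OF c2 d] by blast
        have "norm (\<Sum>i\<in>{m..<n}. q x * (a i * X i x) - a i * (ev i * X i x)) < e"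
          if x: "x \<in> ?S" and m: "m \<ge> max M1 M2" and n: "n > m" for x m n
        proof -
          let ?F = "\<Sum>i\<in>{m..<n}. a i * X i x" and ?G = "\<Sum>i\<in>{m..<n}. a i * (ev i * X i x)"
          have "norm (q x * ?F - ?G) \<le> \<bar>q x\<bar> * \<bar>?F\<bar> + \<bar>?G\<bar>"
            using abs_triangle_ineq4[of "q x * ?F" "?G"] by (simp add: abs_mult)
          moreover have "\<bar>q x\<bar> * \<bar>?F\<bar> \<le> Q * d"
            using Q(1)[OF sub[OF x]] M1[OF sub[OF x], of m n] m n Q(2) by (intro mult_mono) auto
          moreover have "\<bar>?G\<bar> < d" using M2[OF sub[OF x], of m n] m n by auto
          ultimately have "norm (q x * ?F - ?G) < (Q + 1) * d" by (simp add: distrib_right)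
          also have "\<dots> = e" using Q(2) by (simp add: d_def)
          finally show ?thesis by (simp add: sum_subtractf sum_distrib_left)
        qed
        then show "\<exists>M. \<forall>x\<in>?S. \<forall>m\<ge>M. \<forall>n>m. norm (\<Sum>i\<in>{m..<n}. q x * (a i * X i x) - a i * (ev i * X i x)) < e"
          by blast
      qed
      show "((\<lambda>x. p x * (a n * X' n x)) has_real_derivative q x * (a n * X n x) - a n * (ev n * X n x)) (at x within ?S)"
        if x: "x \<in> ?S" for n x
      proof -
        have "((\<lambda>y. p y * X' n y) has_real_derivative q x * X n x - ev n * X n x) (at x)"
          using X_bvp[of n] x by (simp add: SL_bvp_def)
        from DERIV_cmult[OF this, of "a n"] show ?thesis
          unfolding atS[OF x] by (simp add: algebra_simps)
      qed
      show "summable (\<lambda>n. p (l / 2) * (a n * X' n (l / 2)))"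
        using lim3(2)[OF half] by (rule summable_mult)
    qed (use x half intS in auto)
    moreover have "(\<Sum>i. q x * (a i * X i x) - a i * (ev i * X i x)) = q x * (\<Sum>i. a i * X i x) - (\<Sum>i. a i * (ev i * X i x))"
      using lim1(2)[OF sub[OF x]] lim2(2)[OF sub[OF x]]
      by (subst suminf_diff [symmetric]) (auto simp: suminf_mult summable_mult)
    ultimately have D: "((\<lambda>x. \<Sum>i. p x * (a i * X' i x)) has_real_derivative q x * (\<Sum>i. a i * X i x) - (\<Sum>i. a i * (ev i * X i x))) (at x)"
      by simp
    show ?thesis
      by (rule has_field_derivative_transform_within_open[OF D, of ?S])
        (use x lim3(2) in \<open>auto simp: u1_def suminf_mult\<close>)
  qed
  ultimately show ?thesis by blast
qed

section \<open>The Fourier series solves the problem\<close>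

text \<open>Two majorants suffice: the Fourier series of \<open>u\<^sub>0\<close> and, since its coefficients are
  \<open>ev i * c i\<close>, that of \<open>g = L u\<^sub>0\<close>. The time factors are bounded by \<open>1\<close>, so both remain majorants
  for every \<open>t \<ge> 0\<close>.\<close>

lemma fourier_series_solves_diffusion:
  assumes \<alpha>: "0 < \<alpha>" "\<alpha> \<le> 1" and u0: "u0 \<in> SL_space l p q"
    and g: "g \<in> SL_space l p q" "\<And>x. x \<in> {0<..<l} \<Longrightarrow> g x = SL_op p q u0 x"
  defines "u \<equiv> \<lambda>x t. \<Sum>i. L2_inner l u0 (X i) * mittag_leffler \<alpha> (- ev i * t powr \<alpha>) * X i x"
  shows "diffusion_solution \<alpha> l T p q u0 u"
    and "x \<in> {0..l} \<Longrightarrow> 0 \<le> t \<Longrightarrow>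
      (\<lambda>i. L2_inner l u0 (X i) * mittag_leffler \<alpha> (- ev i * t powr \<alpha>) * X i x) sums u x t"
proof -
  define c where "c i = L2_inner l u0 (X i)" for i
  define y where "y i t = mittag_leffler \<alpha> (- ev i * t powr \<alpha>)" for i t
  have u_def': "u x t = (\<Sum>i. c i * y i t * X i x)" for x t by (simp add: u_def c_def y_def)
  obtain u1 where "SL_bvp l p q u0 u1 (SL_op p q u0)" using SL_space_imp_bvp[OF p_C1 u0] ..
  then have u0_bvp: "SL_bvp l p q u0 u1 g" using g(2) by (auto intro: SL_bvp_cong)
  obtain g1 where g_bvp: "SL_bvp l p q g g1 (SL_op p q g)" using SL_space_imp_bvp[OF p_C1 g(1)] ..
  have gc: "L2_inner l g (X i) = ev i * c i" for i
    unfolding c_def by (rule fourier_coefficient[OF u0_bvp])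
  have e0: "0 \<le> ev i" for i using ev_pos[of i] by simp
  have yb: "\<bar>y i t\<bar> \<le> 1" if "0 \<le> t" for i t
    using mittag_leffler_bounds[OF \<alpha> e0 that, of i] by (auto simp: y_def)
  have UC: "uniformly_Cauchy_on {0..l} (\<lambda>n x. \<Sum>i<n. \<bar>c i * X i x\<bar>)"
    unfolding c_def by (rule fourier_series_uniformly_Cauchy[OF u0_bvp])
  have UE: "uniformly_Cauchy_on {0..l} (\<lambda>n x. \<Sum>i<n. \<bar>ev i * c i * X i x\<bar>)"
    using fourier_series_uniformly_Cauchy[OF g_bvp] unfolding gc .
  have UCt: "uniformly_Cauchy_on ({0..l} \<times> {0..}) (\<lambda>n z. \<Sum>i<n. c i * y i (snd z) * X i (fst z))"
  proof (rule uniformly_Cauchy_on_series_dominated[OF UC, where \<phi> = fst and K = 1])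
    fix i :: nat and z :: "real \<times> real" assume "z \<in> {0..l} \<times> {0..}"
    then have "\<bar>c i * X i (fst z)\<bar> * \<bar>y i (snd z)\<bar> \<le> \<bar>c i * X i (fst z)\<bar>"
      using yb[of "snd z" i] by (intro mult_left_le) auto
    then show "norm (c i * y i (snd z) * X i (fst z)) \<le> 1 * \<bar>c i * X i (fst z)\<bar>"
      by (simp add: abs_mult mult_ac)
  qed auto
  have UEt: "uniformly_Cauchy_on {0..l} (\<lambda>n x. \<Sum>i<n. c i * y i t * (ev i * X i x))" if "0 \<le> t" for t
  proof (rule uniformly_Cauchy_on_series_dominated[OF UE, where \<phi> = id and K = 1])
    fix i :: nat and x :: real
    have "\<bar>ev i * c i * X i x\<bar> * \<bar>y i t\<bar> \<le> \<bar>ev i * c i * X i x\<bar>"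
      using yb[OF that, of i] by (intro mult_left_le) auto
    then show "norm (c i * y i t * (ev i * X i x)) \<le> 1 * \<bar>ev i * c i * X i (id x)\<bar>"
      by (simp add: abs_mult mult_ac)
  qed auto
  have UCx: "uniformly_Cauchy_on {0..l} (\<lambda>n x. \<Sum>i<n. c i * y i t * X i x)" if "0 \<le> t" for t
    using UCt that unfolding uniformly_Cauchy_on_def by fastforce
  note limC = uniformly_Cauchy_on_imp_uniform_limit_suminf[OF UCt]
  show "(\<lambda>i. L2_inner l u0 (X i) * mittag_leffler \<alpha> (- ev i * t powr \<alpha>) * X i x) sums u x t"
    if "x \<in> {0..l}" "0 \<le> t" for x t
    using summable_sums[OF limC(2)[of "(x, t)"]] that by (simp add: u_def c_def y_def)
  have yc: "continuous_on {0..} (y i)" for i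
    unfolding y_def mittag_leffler_conv_ml2 using \<alpha> by (intro continuous_on_ml2_powr) auto
  have ucont: "continuous_on ({0..l} \<times> {0..}) (\<lambda>(x, t). u x t)"
  proof -
    have "continuous_on ({0..l} \<times> {0..}) (\<lambda>z. \<Sum>i. c i * y i (snd z) * X i (fst z))"
    proof (rule uniform_limit_theorem[OF _ limC(1)])
      have "continuous_on ({0..l} \<times> {0..}) (\<lambda>z. y i (snd z))" for i
        by (rule continuous_on_compose2[OF yc continuous_on_snd]) (auto intro!: continuous_intros)
      moreover have "continuous_on ({0..l} \<times> {0..}) (\<lambda>z. X i (fst z))" for i
        by (rule continuous_on_compose2[OF X_cont continuous_on_fst]) (auto intro!: continuous_intros)
      ultimately show "\<forall>\<^sub>F n in sequentially. continuous_on ({0..l} \<times> {0..}) (\<lambda>z. \<Sum>i<n. c i * y i (snd z) * X i (fst z))"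
        by (intro always_eventually allI continuous_intros)
    qed auto
    then show ?thesis by (simp add: u_def' case_prod_unfold)
  qed
  have time: "(\<lambda>t. u x t) \<in> W1 T"
      "0 < t \<Longrightarrow> caputo_deriv \<alpha> (\<lambda>t. u x t) t = - (\<Sum>i. c i * y i t * (ev i * X i x))"
    if x: "x \<in> {0..l}" for x t
  proof -
    have 1: "summable (\<lambda>i. \<bar>c i * X i x\<bar>)" "summable (\<lambda>i. \<bar>ev i * (c i * X i x)\<bar>)"
      using uniformly_Cauchy_on_imp_uniform_limit_suminf(2)[OF UC x]
        uniformly_Cauchy_on_imp_uniform_limit_suminf(2)[OF UE x] by (auto simp: mult.assoc)
    have u_eq: "(\<lambda>t. u x t) = (\<lambda>t. \<Sum>i. (c i * X i x) * mittag_leffler \<alpha> (- ev i * t powr \<alpha>))"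
      by (simp add: u_def' y_def mult_ac)
    show "(\<lambda>t. u x t) \<in> W1 T"
      unfolding u_eq by (rule relaxation_superposition(1)[OF \<alpha> e0 1])
    show "caputo_deriv \<alpha> (\<lambda>t. u x t) t = - (\<Sum>i. c i * y i t * (ev i * X i x))" if "0 < t"
      unfolding u_eq relaxation_superposition(2)[OF \<alpha> e0 1 that] by (simp add: y_def mult_ac)
  qed
  have space: "Ck_on 2 {0<..<l} (\<lambda>x. u x t)"
    "x \<in> {0<..<l} \<Longrightarrow> deriv (\<lambda>y. p y * deriv (\<lambda>z. u z t) y) x = q x * u x t - (\<Sum>i. c i * y i t * (ev i * X i x))"
    if t: "0 \<le> t" for t x
  proof -
    let ?w = "\<lambda>x. \<Sum>i. c i * y i t * (ev i * X i x)"
    obtain v where v: "\<And>x. x \<in> {0<..<l} \<Longrightarrow> ((\<lambda>x. u x t) has_real_derivative v x) (at x)"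
      "\<And>x. x \<in> {0<..<l} \<Longrightarrow> ((\<lambda>y. p y * v y) has_real_derivative q x * u x t - ?w x) (at x)"
      using termwise_SL_operator[OF UCx[OF t] UEt[OF t]] unfolding u_def' by blast
    have "continuous_on {0..l} ?w"
      by (rule uniform_limit_theorem[OF _ uniformly_Cauchy_on_imp_uniform_limit_suminf(1)[OF UEt[OF t]]])
        (auto intro!: always_eventually continuous_intros X_cont)
    moreover have "continuous_on {0<..<l} (\<lambda>x. u x t)"
      by (rule DERIV_continuous_on[OF v(1)[THEN has_field_derivative_at_within]])
    ultimately have "continuous_on {0<..<l} (\<lambda>x. q x * u x t - ?w x)"
      by (intro continuous_intros) (auto intro: continuous_on_subset[OF q_cont] continuous_on_subset)
    note flux = Ck_on_2_of_flux[OF p_C1 p_pos v this]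
    show "Ck_on 2 {0<..<l} (\<lambda>x. u x t)" by (rule flux(1))
    show "deriv (\<lambda>y. p y * deriv (\<lambda>z. u z t) y) x = q x * u x t - ?w x" if "x \<in> {0<..<l}"
      by (rule flux(2)) (use that in auto)
  qed
  have X0: "X i 0 = 0" "X i l = 0" for i using X_bvp[of i] by (auto simp: SL_bvp_def)
  have init: "u x 0 = u0 x" if "x \<in> {0..l}" for x
    using fourier_expansion[OF u0_bvp that] \<alpha>
    by (simp add: u_def' c_def y_def mittag_leffler_conv_ml2 sums_iff)
  show "diffusion_solution \<alpha> l T p q u0 u"
    unfolding diffusion_solution_def
  proof (intro conjI ballI)
    show "continuous_on ({0..l} \<times> {0..T}) (\<lambda>(x, t). u x t)" by (rule continuous_on_subset[OF ucont]) auto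
    show "u 0 t = 0" "u l t = 0" for t by (simp_all add: u_def' X0)
    fix x t assume "x \<in> {0<..<l}" "t \<in> {0<..<T}"
    then show "caputo_deriv \<alpha> (\<lambda>s. u x s) t = deriv (\<lambda>y. p y * deriv (\<lambda>z. u z t) y) x - q x * u x t"
      using time(2)[of x t] space(2)[of t x] by simp
  qed (use time(1) space(1) init in auto)
qed

end

section \<open>Maximum principle and uniqueness\<close>

text \<open>A positive value of \<open>v - w\<close> survives the perturbation by \<open>- \<epsilon> t\<close>, so the perturbed difference has a
  positive maximum over the time strip, off the parabolic boundary. There the equation
  contradicts the two extremum principles in time and in space.\<close>

lemma diffusion_solution_le:
  assumes \<alpha>: "0 < \<alpha>" "\<alpha> \<le> 1" and p: "Ck_on 1 {0..l} p" and ppos: "\<And>x. x \<in> {0..l} \<Longrightarrow> 0 < p x"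
    and q: "\<And>x. x \<in> {0..l} \<Longrightarrow> 0 \<le> q x"
    and v: "diffusion_solution \<alpha> l T p q u0 v" and w: "diffusion_solution \<alpha> l T p q u0 w"
    and x1: "x1 \<in> {0..l}" and t1: "0 \<le> t1" "t1 < T"
  shows "v x1 t1 \<le> w x1 t1"
proof (rule ccontr)
  assume "\<not> v x1 t1 \<le> w x1 t1"
  define M where "M = v x1 t1 - w x1 t1"
  have M: "M > 0" using \<open>\<not> _\<close> by (simp add: M_def)
  have "t1 \<noteq> 0" using M x1 v w by (auto simp: M_def diffusion_solution_def)
  then have t1p: "0 < t1" using t1 by auto
  \<comment> \<open>The perturbation takes away half of the excess at \<open>(x1, t1)\<close>.\<close>
  define \<epsilon> where "\<epsilon> = M / (2 * t1)"
  have \<epsilon>: "\<epsilon> > 0" using M t1p by (simp add: \<epsilon>_def)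
  define W where "W = (\<lambda>(x, t). v x t - w x t - \<epsilon> * t)"
  have cv: "continuous_on ({0..l} \<times> {0..t1}) (\<lambda>(x, t). v x t)"
    and cw: "continuous_on ({0..l} \<times> {0..t1}) (\<lambda>(x, t). w x t)"
    using v w t1 by (auto simp: diffusion_solution_def intro: continuous_on_subset)
  have "continuous_on ({0..l} \<times> {0..t1}) W"
    using continuous_on_diff[OF continuous_on_diff[OF cv cw], of "\<lambda>z. \<epsilon> * snd z"]
    by (simp add: W_def case_prod_unfold continuous_intros)
  moreover have "compact ({0..l} \<times> {0..t1})" by (intro compact_Times) auto
  ultimately obtain z0 where z0: "z0 \<in> {0..l} \<times> {0..t1}" "\<And>z. z \<in> {0..l} \<times> {0..t1} \<Longrightarrow> W z \<le> W z0"
    using continuous_attains_sup[of "{0..l} \<times> {0..t1}" W] x1 t1 by auto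
  obtain x0 t0 where [simp]: "z0 = (x0, t0)" by (cases z0)
  have x0: "x0 \<in> {0..l}" and t0: "t0 \<in> {0..t1}" using z0(1) by auto
  have max: "v x t - w x t - \<epsilon> * t \<le> v x0 t0 - w x0 t0 - \<epsilon> * t0" if "x \<in> {0..l}" "t \<in> {0..t1}" for x t
    using z0(2)[of "(x, t)"] that by (simp add: W_def)
  have "\<epsilon> * t1 = M / 2" using t1p by (simp add: \<epsilon>_def)
  then have "M / 2 \<le> v x0 t0 - w x0 t0 - \<epsilon> * t0"
    using max[of x1 t1] x1 t1p by (simp add: M_def)
  then have pos: "0 < v x0 t0 - w x0 t0 - \<epsilon> * t0" using M by simp
  moreover have "0 \<le> \<epsilon> * t0" using \<epsilon> t0 by auto
  ultimately have dpos: "0 < v x0 t0 - w x0 t0" by simp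
  have T0: "t0 \<in> {0..T}" using t0 t1 by auto
  have "t0 \<noteq> 0" using dpos x0 v w by (auto simp: diffusion_solution_def)
  then have t0p: "0 < t0" "t0 < T" using t0 t1 by auto
  have "x0 \<noteq> 0" "x0 \<noteq> l" using dpos T0 v w by (auto simp: diffusion_solution_def)
  then have x0i: "x0 \<in> {0<..<l}" using x0 by auto
  have ct: "continuous_on {0..t0} (\<lambda>t. v x0 t)" "continuous_on {0..t0} (\<lambda>t. w x0 t)"
    using continuous_on_compose2[OF cv, of "{0..t0}" "\<lambda>t. (x0, t)"]
      continuous_on_compose2[OF cw, of "{0..t0}" "\<lambda>t. (x0, t)"] x0 t0
      continuous_on_Pair[OF continuous_on_const[of "{0..t0}" x0] continuous_on_id[of "{0..t0}"]]
    by (auto simp: image_subset_iff)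
  have "caputo_deriv \<alpha> (\<lambda>t. w x0 t) t0 < caputo_deriv \<alpha> (\<lambda>t. v x0 t) t0"
  proof (rule caputo_deriv_less_at_max[OF \<alpha> \<epsilon> t0p])
    show "(\<lambda>t. v x0 t) \<in> W1 T" "(\<lambda>t. w x0 t) \<in> W1 T" using v w x0 by (auto simp: diffusion_solution_def)
    show "v x0 \<tau> - w x0 \<tau> - \<epsilon> * \<tau> \<le> v x0 t0 - w x0 t0 - \<epsilon> * t0" if "\<tau> \<in> {0..t0}" for \<tau>
      using that t0 x0 by (intro max) auto
  qed (use ct in auto)
  moreover have "caputo_deriv \<alpha> (\<lambda>t. v x0 t) t0 = deriv (\<lambda>y. p y * deriv (\<lambda>z. v z t0) y) x0 - q x0 * v x0 t0"
    "caputo_deriv \<alpha> (\<lambda>t. w x0 t) t0 = deriv (\<lambda>y. p y * deriv (\<lambda>z. w z t0) y) x0 - q x0 * w x0 t0"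
    using v w x0i t0p by (auto simp: diffusion_solution_def)
  moreover have "deriv (\<lambda>y. p y * deriv (\<lambda>z. v z t0) y) x0 - deriv (\<lambda>y. p y * deriv (\<lambda>z. w z t0) y) x0 \<le> 0"
  proof (rule flux_derivative_nonpos_at_max[OF x0i])
    have C: "Ck_on 2 {0<..<l} (\<lambda>z. v z t0)" "Ck_on 2 {0<..<l} (\<lambda>z. w z t0)"
      using v w T0 by (auto simp: diffusion_solution_def)
    show "0 < p y" if "y \<in> {0<..<l}" for y using ppos that by auto
    show "((\<lambda>z. v z t0 - w z t0) has_real_derivative deriv (\<lambda>z. v z t0) y - deriv (\<lambda>z. w z t0) y) (at y)"
      if "y \<in> {0<..<l}" for y
      by (intro DERIV_diff SL_interior_regularity(1)[OF p _ that] C)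
    have "((\<lambda>y. p y * deriv (\<lambda>z. v z t0) y - p y * deriv (\<lambda>z. w z t0) y) has_real_derivative
        deriv (\<lambda>y. p y * deriv (\<lambda>z. v z t0) y) x0 - deriv (\<lambda>y. p y * deriv (\<lambda>z. w z t0) y) x0) (at x0)"
      by (intro DERIV_diff SL_interior_regularity(2)[OF p _ x0i] C)
    then show "((\<lambda>y. p y * (deriv (\<lambda>z. v z t0) y - deriv (\<lambda>z. w z t0) y)) has_real_derivative
        deriv (\<lambda>y. p y * deriv (\<lambda>z. v z t0) y) x0 - deriv (\<lambda>y. p y * deriv (\<lambda>z. w z t0) y) x0) (at x0)"
      by (simp add: right_diff_distrib)
    show "v y t0 - w y t0 \<le> v x0 t0 - w x0 t0" if "y \<in> {0<..<l}" for y
      using max[of y t0] that t0 by auto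
  qed
  moreover have "0 \<le> q x0 * (v x0 t0 - w x0 t0)" using q[OF x0] dpos by simp
  ultimately show False by (simp add: right_diff_distrib)
qed

text \<open>The equation holds only for \<open>t < T\<close>; the value at \<open>T\<close> follows by continuity.\<close>

lemma diffusion_solution_unique:
  assumes \<alpha>: "0 < \<alpha>" "\<alpha> \<le> 1" and T: "0 < T" and p: "Ck_on 1 {0..l} p" and ppos: "\<And>x. x \<in> {0..l} \<Longrightarrow> 0 < p x"
    and q: "\<And>x. x \<in> {0..l} \<Longrightarrow> 0 \<le> q x"
    and v: "diffusion_solution \<alpha> l T p q u0 v" and w: "diffusion_solution \<alpha> l T p q u0 w"
    and x: "x \<in> {0..l}" and t: "t \<in> {0..T}"
  shows "v x t = w x t"
proof -
  have eq: "v x s - w x s = 0" if "s \<in> {0<..<T}" for s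
    using diffusion_solution_le[OF \<alpha> p ppos q v w x, of s] diffusion_solution_le[OF \<alpha> p ppos q w v x, of s] that
    by auto
  have cv: "continuous_on ({0..l} \<times> {0..T}) (\<lambda>(x, t). v x t)"
    and cw: "continuous_on ({0..l} \<times> {0..T}) (\<lambda>(x, t). w x t)"
    using v w by (auto simp: diffusion_solution_def)
  have c: "continuous_on {0..T} (\<lambda>t. v x t)" "continuous_on {0..T} (\<lambda>t. w x t)"
    using continuous_on_compose2[OF cv, of "{0..T}" "\<lambda>t. (x, t)"]
      continuous_on_compose2[OF cw, of "{0..T}" "\<lambda>t. (x, t)"] x
      continuous_on_Pair[OF continuous_on_const[of "{0..T}" x] continuous_on_id[of "{0..T}"]]
    by (auto simp: image_subset_iff)
  have cl: "closure {0<..<T} = {0..T}" using T by simp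
  have "v x t - w x t = 0"
    by (rule continuous_constant_on_closure[of "{0<..<T}" "\<lambda>s. v x s - w x s"])
      (use c eq t in \<open>auto simp: cl intro!: continuous_intros\<close>)
  then show ?thesis by simp
qed

section \<open>Existence, uniqueness and representation\<close>

theorem theorem5:
  fixes \<alpha> l T :: real
    and p q u0 :: "real \<Rightarrow> real"
    and ev :: "nat \<Rightarrow> real"
    and X :: "nat \<Rightarrow> real \<Rightarrow> real"
  assumes "0 < \<alpha>" and "\<alpha> \<le> 1" and "0 < l" and "0 < T"
    and "Ck_on 1 {0..l} p" and "continuous_on {0..l} q"
    and "\<forall>x\<in>{0..l}. 0 < p x" and "\<forall>x\<in>{0..l}. 0 \<le> q x"
    and "SL_eigensystem l p q ev X"
    and "u0 \<in> SL_space l p q"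
    and "\<exists>g\<in>SL_space l p q. \<forall>x\<in>{0<..<l}. g x = SL_op p q u0 x"
  shows "\<exists>u. diffusion_solution \<alpha> l T p q u0 u \<and>
             (\<forall>v. diffusion_solution \<alpha> l T p q u0 v \<longrightarrow>
                    (\<forall>x\<in>{0..l}. \<forall>t\<in>{0..T}. v x t = u x t)) \<and>
             (\<forall>x\<in>{0..l}. \<forall>t\<in>{0..T}.
                (\<lambda>i. L2_inner l u0 (X i) * mittag_leffler \<alpha> (- ev i * t powr \<alpha>) * X i x)
                  sums u x t)"
proof -
  interpret SL_system l p q ev X
    using assms by unfold_locales auto
  obtain g where g: "g \<in> SL_space l p q" "\<And>x. x \<in> {0<..<l} \<Longrightarrow> g x = SL_op p q u0 x"
    using assms(11) by blast
  let ?u = "\<lambda>x t. \<Sum>i. L2_inner l u0 (X i) * mittag_leffler \<alpha> (- ev i * t powr \<alpha>) * X i x"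
  have u: "diffusion_solution \<alpha> l T p q u0 ?u"
    by (rule fourier_series_solves_diffusion(1)[OF assms(1,2,10) g])
  show ?thesis
  proof (intro exI[of _ ?u] conjI allI impI ballI)
    fix v x t assume "diffusion_solution \<alpha> l T p q u0 v" "x \<in> {0..l}" "t \<in> {0..T}"
    then show "v x t = ?u x t"
      by (intro diffusion_solution_unique[OF assms(1,2,4,5) p_pos q_nonneg _ u])
  next
    fix x t assume "x \<in> {0..l}" "t \<in> {0..T}"
    then show "(\<lambda>i. L2_inner l u0 (X i) * mittag_leffler \<alpha> (- ev i * t powr \<alpha>) * X i x) sums ?u x t"
      by (intro fourier_series_solves_diffusion(2)[OF assms(1,2,10) g]) auto
  qed (rule u)
qed

end
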